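(* Let $n \geq 0$ be an integer. The Hopf ladder $H_n$ with $n$ rungs is achiral if $0 \leq n \leq 2$, and it is chiral if $n \geq 3$.
   Context: A spatial graph $\mathcal{G}$ is the image of an embedding $f: G \rightarrow \mathbb{R}^3$ of a finite abstract graph $G$ (edges tamely embedded; a knot or link is regarded as a spatial graph), considered up to ambient isotopy. A spatial graph is chiral if it is not ambient isotopic to its mirror image, and achiral otherwise. Being achiral is equivalent to the existence of an orientation-reversing homeomorphism of $\mathbb{R}^3$ that maps the spatial graph onto itself (as a set; no labelling of edges, sides or rungs, nor any orientation of link components, is required to be preserved). The Hopf ladder $H_n$ is the spatial graph obtained from a Hopf link (whose two components are called the sides) by adding $n$ pairs of vertices $(v^1_1, v^2_1), \dots, (v^1_n, v^2_n)$, where $v^1_1, \dots, v^1_n$ lie on one link component and $v^2_1, \dots, v^2_n$ lie on the other, and by adding $n$ edges $e_1, \dots, e_n$, called rungs, where $e_i$ has endpoints $v^1_i, v^2_i$, in such a way that the rungs do not introduce any crossings in a diagram of the spatial graph. The rungs are arranged as in a ladder, i.e. they are met in the same cyclic order along the two sides. Concretely: let $A \subset \mathbb{R}^3$ be an embedded annulus with unknotted core and one full twist, so that $\partial A$ is a Hopf link; then $H_n$ is the union of $\partial A$ with $n$ pairwise disjoint properly embedded arcs in $A$, each connecting the two components of $\partial A$. The two possible handednesses of the full twist give mirror images of one another, so the choice does not affect chirality. $H_0$ is the (unoriented) Hopf link. *)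

theory Defs
  imports "HOL-Analysis.Analysis"
begin

(* Spatial graphs are treated as subsets of R^3: no labelling or orientation is part of the
   structure.  An ambient isotopy is a continuous family of homeomorphisms of R^3 that starts
   at the identity; its end map carries X onto Y. *)
definition ambient_isotopic :: "(real^3) set \<Rightarrow> (real^3) set \<Rightarrow> bool" where
  "ambient_isotopic X Y \<longleftrightarrow>
     (\<exists>h. homotopic_with_canon (\<lambda>f. \<exists>g. homeomorphism UNIV UNIV f g) UNIV UNIV id h \<and> h ` X = Y)"

definition mirror :: "real^3 \<Rightarrow> real^3" where
  "mirror x = vector [x $ 1, x $ 2, - (x $ 3)]"

definition chiral :: "(real^3) set \<Rightarrow> bool" where
  "chiral X \<longleftrightarrow> \<not> ambient_isotopic X (mirror ` X)"

definition achiral :: "(real^3) set \<Rightarrow> bool" where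
  "achiral X \<longleftrightarrow> \<not> chiral X"

(* For s in [-1, 1] this parametrises an embedded annulus whose core (s = 0) is the round circle
   of radius 2 in the horizontal plane: t is the angle along the core, s the coordinate across
   the annulus.  The direction of the s-axis is e_r * cos t + e * e_z * sin t, with e_r the
   horizontal radial unit vector at angle t, so it makes one full turn around the core; the
   handedness of this full twist is e = 1 or e = -1. *)
definition annulus_point :: "real \<Rightarrow> real \<Rightarrow> real \<Rightarrow> real^3" where
  "annulus_point e t s =
     vector [(2 + s * cos t) * cos t, (2 + s * cos t) * sin t, e * s * sin t]"

definition sides :: "real \<Rightarrow> (real^3) set" where
  "sides e = {annulus_point e t s | t s. s \<in> {-1, 1}}"

definition rung :: "real \<Rightarrow> real \<Rightarrow> (real^3) set" where
  "rung e t = annulus_point e t ` {-1..1}"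

definition standard_hopf_ladder :: "real \<Rightarrow> nat \<Rightarrow> (real^3) set" where
  "standard_hopf_ladder e n = sides e \<union> (\<Union>k<n. rung e (2 * pi * real k / real n))"

(* The Hopf ladder with n rungs is an ambient isotopy class; the full twist may have either
   handedness. *)
definition hopf_ladder :: "nat \<Rightarrow> (real^3) set \<Rightarrow> bool" where
  "hopf_ladder n L \<longleftrightarrow> (\<exists>e\<in>{-1, 1}. ambient_isotopic (standard_hopf_ladder e n) L)"

lemma ambient_isotopic_refl: "ambient_isotopic X X"
  unfolding ambient_isotopic_def
  by (rule exI[of _ id]) (auto simp: homotopic_with_refl intro: homeomorphism_ident[unfolded id_def[symmetric]] continuous_on_id)

lemma mirror_standard_hopf_ladder:
  "mirror ` standard_hopf_ladder e n = standard_hopf_ladder (- e) n"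
proof -
  have m: "mirror (annulus_point e t s) = annulus_point (- e) t s" for t s
    by (simp add: mirror_def annulus_point_def)
  have "mirror ` sides e = sides (- e)"
    unfolding sides_def by (auto simp: m image_iff) (metis m)+
  moreover have "mirror ` rung e t = rung (- e) t" for t
    by (simp add: rung_def image_image m)
  ultimately show ?thesis
    by (simp add: standard_hopf_ladder_def image_Un image_UN)
qed

end

(* Achirality for at most two rungs: all rungs lie on the first axis, and an isotopy that fixes
   this axis and is linear on each orthogonal plane exchanges the ladder with its mirror image.

   Chirality for at least three rungs: for disjoint loops in the annulus the linking number depends
   only on the winding of the two loops around the core: it is 0 if one of them does not wind around,
   and it is the handedness e if both wind around once in the same direction. An isotopy onto the
   mirror image preserves linking numbers, so it carries the two sides to disjoint essential loops in
   the mirror ladder that do not run once around in the same direction. Two disjoint essential loops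
   in a ladder cover one side each. Hence sides go to sides, rungs go to rungs, and one side is mapped
   preserving the cyclic order of angles and the other one reversing it. But the two maps agree at
   the angles of the rungs, which is impossible if there are three of them.

   The linking number is defined through the Brouwer degree of self-maps of the 3-sphere, so that its
   invariance under isotopies is a homotopy of maps. *)
theory Submission
  imports Defs "HOL-Homology.Homology"
begin

section \<open>Ambient isotopy\<close>

text \<open>An isotopy starts at the identity, so it preserves linking numbers outright, and their
  sign is what tells \<open>e\<close> from \<open>-e\<close>. Loops with winding numbers
  \<open>a\<close> and \<open>b\<close> have linking number \<open>e * a * b\<close>, of which two
  cases are computed: one winding number is 0, or both are 1 or both are -1. Excluding these cases
  suffices, since injectivity along a side later forces each winding number to be 1 or -1, hence the
  two to be opposite. The obstacle in between is that an image loop might leave the sides along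
  rungs. Therefore the image of the sides is first shown to cover the mirror sides, and the inverse
  isotopy then gives equality. Three is the threshold because an orientation-preserving and an
  orientation-reversing homeomorphism of the circle agree at exactly two points.\<close>

definition self_homeo :: "('a::topological_space \<Rightarrow> 'a) \<Rightarrow> bool" where
  "self_homeo f \<longleftrightarrow> (\<exists>g. homeomorphism UNIV UNIV f g)"

lemma self_homeo_compose: "self_homeo f \<Longrightarrow> self_homeo k \<Longrightarrow> self_homeo (k \<circ> f)"
  unfolding self_homeo_def by (meson homeomorphism_compose)

lemma self_homeo_continuous: "self_homeo f \<Longrightarrow> continuous_on UNIV f"
  unfolding self_homeo_def by (meson homeomorphism_cont1)

lemma ambient_isotopic_iff:
  "ambient_isotopic X Y \<longleftrightarrow> (\<exists>h. homotopic_with_canon self_homeo UNIV UNIV id h \<and> h ` X = Y)"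
  unfolding ambient_isotopic_def self_homeo_def[abs_def] ..

lemma ambient_isotopic_trans:
  assumes "ambient_isotopic X Y" "ambient_isotopic Y Z"
  shows "ambient_isotopic X Z"
proof -
  obtain h where h: "homotopic_with_canon self_homeo UNIV UNIV id h" "h ` X = Y"
    using assms(1) unfolding ambient_isotopic_iff by blast
  obtain k where k: "homotopic_with_canon self_homeo UNIV UNIV id k" "k ` Y = Z"
    using assms(2) unfolding ambient_isotopic_iff by blast
  have h': "self_homeo h"
    using homotopic_with_imp_property[OF h(1)] by blast
  have "homotopic_with_canon self_homeo UNIV UNIV (id \<circ> h) (k \<circ> h)"
    by (rule homotopic_with_compose_continuous_map_right[OF k(1)])
       (simp_all add: self_homeo_continuous self_homeo_compose h')
  then have "homotopic_with_canon self_homeo UNIV UNIV id (k \<circ> h)"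
    using h(1) homotopic_with_trans by fastforce
  then show ?thesis
    unfolding ambient_isotopic_iff using h(2) k(2) by (auto simp: image_comp[symmetric])
qed

text \<open>Composing the whole isotopy on the right with the inverse of \<open>h\<close> gives a
  path from that inverse to \<open>id\<close>, which is then reversed. Inverting each stage instead
  would require the inverses to depend continuously on time.\<close>

lemma isotopy_inverse:
  assumes h: "homotopic_with_canon self_homeo UNIV UNIV id h"
  obtains k where "homotopic_with_canon self_homeo UNIV UNIV id k" "k \<circ> h = id" "h \<circ> k = id"
proof -
  obtain h' where h': "homeomorphism UNIV UNIV h h'"
    using homotopic_with_imp_property[OF h] unfolding self_homeo_def by blast
  then have h'': "self_homeo h'"
    unfolding self_homeo_def by (meson homeomorphism_symD)
  have "homotopic_with_canon self_homeo UNIV UNIV (id \<circ> h') (h \<circ> h')"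
    by (rule homotopic_with_compose_continuous_map_right[OF h])
       (simp_all add: self_homeo_continuous self_homeo_compose h'')
  moreover have *: "h \<circ> h' = id" "h' \<circ> h = id"
    using h' by (auto simp: homeomorphism_def fun_eq_iff)
  ultimately have "homotopic_with_canon self_homeo UNIV UNIV id h'"
    by (simp add: homotopic_with_sym)
  with * show thesis using that by blast
qed

lemma ambient_isotopic_sym:
  assumes "ambient_isotopic X Y"
  shows "ambient_isotopic Y X"
proof -
  obtain h where h: "homotopic_with_canon self_homeo UNIV UNIV id h" "h ` X = Y"
    using assms unfolding ambient_isotopic_iff by blast
  obtain k where k: "homotopic_with_canon self_homeo UNIV UNIV id k" "k \<circ> h = id"
    using isotopy_inverse[OF h(1)] by blast
  have "k ` Y = X"
    unfolding h(2)[symmetric] image_comp k(2) by simp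
  then show ?thesis
    unfolding ambient_isotopic_iff using k(1) by blast
qed

lemma mirror_mirror [simp]: "mirror (mirror x) = x"
  by (simp add: mirror_def vec_eq_iff forall_3)

lemma continuous_on_vector3 [continuous_intros]:
  fixes f g h :: "'a::topological_space \<Rightarrow> real"
  assumes "continuous_on S f" "continuous_on S g" "continuous_on S h"
  shows "continuous_on S (\<lambda>x. vector [f x, g x, h x] :: real^3)"
proof -
  have "vector [a, b, c] = ((\<chi> i. if i = 1 then a else if i = 2 then b else c) :: real^3)" for a b c :: real
    by (simp add: vec_eq_iff forall_3)
  then have "(\<lambda>x. vector [f x, g x, h x] :: real^3) = (\<lambda>x. \<chi> i. if i = 1 then f x else if i = 2 then g x else h x)"
    by auto
  moreover have "continuous_on S (\<lambda>x. (if i = 1 then f x else if i = 2 then g x else h x))" for i :: 3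
    using assms by (cases "i = 1"; cases "i = 2") simp_all
  ultimately show ?thesis
    by (simp only:) (rule continuous_on_vec_lambda)
qed

lemma continuous_on_mirror: "continuous_on S mirror"
  unfolding mirror_def by (intro continuous_intros)

lemma self_homeo_mirror: "self_homeo mirror"
  unfolding self_homeo_def homeomorphism_def
  by (intro exI[of _ mirror]) (simp add: continuous_on_mirror surjI[of mirror mirror])

text \<open>Conjugation by \<open>mirror\<close> fixes \<open>id\<close>, so it turns an isotopy
  into an isotopy.\<close>

lemma ambient_isotopic_mirror:
  assumes "ambient_isotopic X Y"
  shows "ambient_isotopic (mirror ` X) (mirror ` Y)"
proof -
  obtain h where h: "homotopic_with_canon self_homeo UNIV UNIV id h" "h ` X = Y"
    using assms(1) unfolding ambient_isotopic_iff by blast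
  have "homotopic_with_canon self_homeo UNIV UNIV (id \<circ> mirror) (h \<circ> mirror)"
    by (rule homotopic_with_compose_continuous_map_right[OF h(1)])
       (simp_all add: self_homeo_continuous self_homeo_compose self_homeo_mirror)
  then have "homotopic_with_canon self_homeo UNIV UNIV (mirror \<circ> (id \<circ> mirror)) (mirror \<circ> (h \<circ> mirror))"
    by (rule homotopic_with_compose_continuous_map_left)
       (simp_all add: self_homeo_continuous self_homeo_compose self_homeo_mirror)
  moreover have "mirror \<circ> (id \<circ> mirror) = id"
    by auto
  moreover have "(mirror \<circ> (h \<circ> mirror)) ` mirror ` X = mirror ` Y"
    using h(2) by (auto simp: image_image)
  ultimately show ?thesis
    unfolding ambient_isotopic_iff by metis
qed

lemma hopf_ladder_achiral_iff:
  assumes "hopf_ladder n L"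
  obtains e where "e \<in> {-1, 1}"
    "achiral L \<longleftrightarrow> ambient_isotopic (standard_hopf_ladder e n) (standard_hopf_ladder (- e) n)"
proof -
  obtain e where e: "e \<in> {-1, 1}" and L: "ambient_isotopic (standard_hopf_ladder e n) L"
    using assms unfolding hopf_ladder_def by blast
  have L': "ambient_isotopic (standard_hopf_ladder (- e) n) (mirror ` L)"
    using ambient_isotopic_mirror[OF L] by (simp add: mirror_standard_hopf_ladder)
  have "achiral L \<longleftrightarrow> ambient_isotopic (standard_hopf_ladder e n) (standard_hopf_ladder (- e) n)"
    unfolding achiral_def chiral_def not_not
    using L L' ambient_isotopic_sym ambient_isotopic_trans by blast
  with e show thesis by (rule that)
qed

section \<open>Ladders with at most two rungs\<close>

text \<open>Each plane orthogonal to the first axis meets each side in at most two antipodal points. With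
  \<open>a\<close> and \<open>b\<close> as below, \<open>(a, 1)\<close> and \<open>(b, -1)\<close> span the lines through these points. The linear map
  that sends \<open>(a, 1)\<close> to \<open>(a, -1)\<close> and \<open>(b, -1)\<close> to \<open>(-b, -1)\<close> carries the sides to their mirror
  images. Its determinant is 1 and its trace lies strictly between -2 and 2, so the segment that joins
  it to the identity consists of invertible maps, and all of them fix the first axis.\<close>

lemma sides_isotopic_mirror_rel_axis:
  assumes R: "\<And>v. v \<in> R \<Longrightarrow> v $ 2 = 0 \<and> v $ 3 = 0"
  shows "ambient_isotopic (sides 1 \<union> R) (sides (-1) \<union> R)"
proof -
  \<comment> \<open>Solutions of quadratic equations: \<open>a v = 2 + cos t\<close> if
    \<open>v $ 1 = (2 + cos t) * cos t\<close>, and \<open>b v = 2 - cos t\<close> if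
    \<open>v $ 1 = (2 - cos t) * cos t\<close>. The \<open>max 0\<close> extends them continuously
    to planes that miss a side.\<close>
  define a where "a v = 1 + sqrt (max 0 (1 + v $ 1))" for v :: "real^3"
  define b where "b v = 1 + sqrt (max 0 (1 - v $ 1))" for v :: "real^3"
  have a: "a v \<ge> 1" and b: "b v \<ge> 1" for v by (auto simp: a_def b_def)
  have ab: "a v + b v > 0" "a v * b v > 0" for v using a[of v] b[of v] by (auto intro: add_pos_pos mult_pos_pos)
  \<comment> \<open>The matrix with rows \<open>(m, q)\<close> and \<open>(r, m)\<close> runs along
    the segment from the identity to the desired map; \<open>D\<close> is its determinant. For
    nonzero \<open>\<tau>\<close> the entries \<open>q\<close> and \<open>r\<close> have opposite
    signs, hence \<open>D\<close> is positive.\<close>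
  define m where "m \<tau> v = (1 - \<tau>) + \<tau> * ((a v - b v) / (a v + b v))" for \<tau> v
  define q where "q \<tau> v = \<tau> * (2 * a v * b v / (a v + b v))" for \<tau> v
  define r where "r \<tau> v = - \<tau> * (2 / (a v + b v))" for \<tau> v
  define D where "D \<tau> v = (m \<tau> v)^2 - q \<tau> v * r \<tau> v" for \<tau> v
  define h where "h \<tau> v = (vector [v$1, m \<tau> v * v$2 + q \<tau> v * v$3, r \<tau> v * v$2 + m \<tau> v * v$3] :: real^3)" for \<tau> v
  define k where "k \<tau> v = (vector [v$1, (m \<tau> v * v$2 - q \<tau> v * v$3) / D \<tau> v,
       (- r \<tau> v * v$2 + m \<tau> v * v$3) / D \<tau> v] :: real^3)" for \<tau> v
  have D_pos: "D \<tau> v > 0" for \<tau> v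
  proof (cases "\<tau> = 0")
    case True then show ?thesis by (simp add: D_def m_def q_def r_def)
  next
    case False
    have "- (q \<tau> v * r \<tau> v) = 4 * (a v * b v) * (\<tau> / (a v + b v))^2"
      by (simp add: q_def r_def power2_eq_square)
    also have "\<dots> > 0" using ab[of v] False by auto
    finally have "- (q \<tau> v * r \<tau> v) > 0" .
    then show ?thesis unfolding D_def using zero_le_power2[of "m \<tau> v"] by linarith
  qed
  have cab: "continuous_on UNIV (\<lambda>x. a (snd x))" "continuous_on UNIV (\<lambda>x. b (snd x))" for x :: "real \<times> real^3"
    unfolding a_def b_def by (intro continuous_intros)+
  have cm: "continuous_on UNIV (\<lambda>x. m (fst x) (snd x))" "continuous_on UNIV (\<lambda>x. q (fst x) (snd x))"
    "continuous_on UNIV (\<lambda>x. r (fst x) (snd x))"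
    unfolding m_def q_def r_def using ab by (intro continuous_intros cab; simp add: less_imp_neq[symmetric])+
  have ch: "continuous_on UNIV (\<lambda>x. h (fst x) (snd x))"
    unfolding h_def by (intro continuous_intros cm)
  have ck: "continuous_on UNIV (\<lambda>x. k (fst x) (snd x))"
    unfolding k_def using D_pos unfolding D_def
    by (intro continuous_intros cm; simp add: less_imp_neq[symmetric])
  \<comment> \<open>The matrix depends only on the first coordinate, which \<open>h\<close> and
    \<open>k\<close> preserve, so inverting it plane by plane inverts \<open>h\<close>.\<close>
  have same: "m \<tau> v = m \<tau> w" "q \<tau> v = q \<tau> w" "r \<tau> v = r \<tau> w" "D \<tau> v = D \<tau> w"
    if "v $ 1 = w $ 1" for \<tau> v w
    using that by (simp_all add: m_def q_def r_def D_def a_def b_def)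
  have nz: "D \<tau> v \<noteq> 0" for \<tau> v using D_pos[of \<tau> v] by simp
  have kh: "k \<tau> (h \<tau> v) = v" for \<tau> v
  proof -
    have 1: "h \<tau> v $ 1 = v $ 1" by (simp add: h_def)
    have "(m \<tau> v * (m \<tau> v * v$2 + q \<tau> v * v$3) - q \<tau> v * (r \<tau> v * v$2 + m \<tau> v * v$3)) = D \<tau> v * v$2"
      "(- r \<tau> v * (m \<tau> v * v$2 + q \<tau> v * v$3) + m \<tau> v * (r \<tau> v * v$2 + m \<tau> v * v$3)) = D \<tau> v * v$3"
      by (simp_all add: D_def algebra_simps power2_eq_square)
    then show ?thesis
      unfolding k_def same[OF 1] by (simp add: h_def vec_eq_iff forall_3 nz)
  qed
  have hk: "h \<tau> (k \<tau> v) = v" for \<tau> v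
  proof -
    have 1: "k \<tau> v $ 1 = v $ 1" by (simp add: k_def)
    have "m \<tau> v * (m \<tau> v * v$2 - q \<tau> v * v$3) + q \<tau> v * (- r \<tau> v * v$2 + m \<tau> v * v$3) = D \<tau> v * v$2"
      "r \<tau> v * (m \<tau> v * v$2 - q \<tau> v * v$3) + m \<tau> v * (- r \<tau> v * v$2 + m \<tau> v * v$3) = D \<tau> v * v$3"
      by (simp_all add: D_def algebra_simps power2_eq_square)
    then have "m \<tau> v * ((m \<tau> v * v$2 - q \<tau> v * v$3) / D \<tau> v) + q \<tau> v * ((- r \<tau> v * v$2 + m \<tau> v * v$3) / D \<tau> v) = v$2"
      "r \<tau> v * ((m \<tau> v * v$2 - q \<tau> v * v$3) / D \<tau> v) + m \<tau> v * ((- r \<tau> v * v$2 + m \<tau> v * v$3) / D \<tau> v) = v$3"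
      by (simp_all only: times_divide_eq_right add_divide_distrib[symmetric]) (simp_all add: nz)
    then show ?thesis
      unfolding h_def same[OF 1] by (simp add: k_def vec_eq_iff forall_3)
  qed
  have homeo: "self_homeo (h \<tau>)" for \<tau>
  proof -
    have P: "continuous_on UNIV (Pair \<tau> :: real^3 \<Rightarrow> _)"
      by (intro continuous_intros)
    have "continuous_on UNIV (h \<tau>)" "continuous_on UNIV (k \<tau>)"
      using continuous_on_compose2[OF ch P] continuous_on_compose2[OF ck P] by auto
    then show ?thesis
      unfolding self_homeo_def homeomorphism_def
      by (intro exI[of _ "k \<tau>"]) (simp add: hk kh surjI[of "h \<tau>" "k \<tau>"] surjI[of "k \<tau>" "h \<tau>"])
  qed
  have "homotopic_with_canon self_homeo UNIV UNIV id (h 1)"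
    unfolding homotopic_with_def
  proof (intro exI[of _ "\<lambda>x. h (fst x) (snd x)"] conjI allI ballI)
    show "continuous_map (prod_topology (top_of_set {0..1}) (top_of_set UNIV)) (top_of_set UNIV) (\<lambda>x. h (fst x) (snd x))"
      by (simp only: prod_topology_subtopology_eu continuous_map_iff_continuous2) (use continuous_on_subset[OF ch] in auto)
    show "h (fst (0, x)) (snd (0, x)) = id x" for x
      by (simp add: h_def m_def q_def r_def vec_eq_iff forall_3)
  qed (simp_all add: homeo)
  moreover have "h 1 ` (sides 1 \<union> R) = sides (-1) \<union> R"
  proof -
    have m1: "m 1 v = (a v - b v) / (a v + b v)" "q 1 v = 2 * a v * b v / (a v + b v)" "r 1 v = - (2 / (a v + b v))" for v
      by (simp_all add: m_def q_def r_def)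
    have key: "(x - y) / (x + y) * (x * s) + 2 * x * y / (x + y) * s = x * s"
        "- (2 / (x + y)) * (x * s) + (x - y) / (x + y) * s = - s"
        "(x - y) / (x + y) * (y * s) + 2 * x * y / (x + y) * - s = - y * s"
        "- (2 / (x + y)) * (y * s) + (x - y) / (x + y) * - s = - s" if "x + y \<noteq> 0" for x y s :: real
      using that by (simp_all add: divide_simps) (simp_all add: algebra_simps)
    have abnz: "a v + b v \<noteq> 0" for v using ab(1)[of v] by simp
    have pos: "h 1 (annulus_point 1 t 1) = annulus_point (-1) t 1" for t
    proof -
      let ?v = "annulus_point 1 t 1"
      have "1 + ?v $ 1 = (1 + cos t)^2" by (simp add: annulus_point_def power2_eq_square algebra_simps)
      moreover have "0 \<le> 1 + cos t" using cos_ge_minus_one[of t] by linarith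
      ultimately have A: "a ?v = 2 + cos t" unfolding a_def by simp
      have v: "?v $ 2 = a ?v * sin t" "?v $ 3 = sin t" unfolding A by (simp_all add: annulus_point_def)
      have M: "m 1 ?v * ?v$2 + q 1 ?v * ?v$3 = a ?v * sin t" "r 1 ?v * ?v$2 + m 1 ?v * ?v$3 = - sin t"
        unfolding m1 v by (rule key(1,2)[OF abnz])+
      then show ?thesis
        unfolding h_def M A by (simp add: annulus_point_def)
    qed
    \<comment> \<open>The angle is kept on the first side but reversed on the second: the
      orientation behaviour that three rungs will rule out.\<close>
    have neg: "h 1 (annulus_point 1 t (-1)) = annulus_point (-1) (-t) (-1)" for t
    proof -
      let ?v = "annulus_point 1 t (-1)"
      have "1 - ?v $ 1 = (1 - cos t)^2" by (simp add: annulus_point_def power2_eq_square algebra_simps)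
      then have B: "b ?v = 2 - cos t" unfolding b_def by simp
      have v: "?v $ 2 = b ?v * sin t" "?v $ 3 = - sin t" unfolding B by (simp_all add: annulus_point_def)
      have M: "m 1 ?v * ?v$2 + q 1 ?v * ?v$3 = - b ?v * sin t" "r 1 ?v * ?v$2 + m 1 ?v * ?v$3 = - sin t"
        unfolding m1 v by (rule key(3,4)[OF abnz])+
      then show ?thesis
        unfolding h_def M B by (simp add: annulus_point_def algebra_simps)
    qed
    have s: "sides e = range (\<lambda>t. annulus_point e t 1) \<union> range (\<lambda>t. annulus_point e t (-1))" for e
      by (auto simp: sides_def)
    have "range (\<lambda>t. annulus_point (-1) (-t) (-1)) = range (\<lambda>t. annulus_point (-1) t (-1))"
      by (auto simp: image_iff) (metis minus_minus)
    then have "h 1 ` sides 1 = sides (-1)"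
      by (simp add: s image_Un image_image pos neg)
    moreover have "h 1 v = v" if "v \<in> R" for v
      using R[OF that] by (simp add: h_def vec_eq_iff forall_3)
    then have "h 1 ` R = R" by simp
    ultimately show ?thesis by (simp add: image_Un)
  qed
  ultimately show ?thesis
    unfolding ambient_isotopic_iff by blast
qed

lemma standard_hopf_ladder_isotopic_mirror:
  assumes "n \<le> 2" "e \<in> {-1, 1}"
  shows "ambient_isotopic (standard_hopf_ladder e n) (standard_hopf_ladder (- e) n)"
proof -
  let ?R = "\<lambda>e. (\<Union>k<n. rung e (2 * pi * real k / real n))"
  have sc: "sin (2 * pi * real k / real n) = 0" if "k < n" for k
  proof -
    have "k = 0 \<or> k = 1 \<and> n = 2" using that assms(1) by auto
    then show ?thesis by auto
  qed
  have rung: "rung e t = rung 1 t" if "sin t = 0" for e t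
    using that by (simp add: rung_def annulus_point_def)
  have R: "?R e = ?R 1" for e
    by (rule SUP_cong[OF refl rung[OF sc]]) simp
  have "v $ 2 = 0 \<and> v $ 3 = 0" if v: "v \<in> ?R 1" for v
  proof -
    obtain k s where "k < n" "v = annulus_point 1 (2 * pi * real k / real n) s"
      using v by (auto simp: rung_def)
    then show ?thesis
      using sc[of k] by (simp add: annulus_point_def)
  qed
  then have "ambient_isotopic (standard_hopf_ladder 1 n) (standard_hopf_ladder (- 1) n)"
    unfolding standard_hopf_ladder_def R[of "-1"] by (rule sides_isotopic_mirror_rel_axis)
  then show ?thesis
    using assms(2) ambient_isotopic_sym by auto
qed

section \<open>Degrees of self-maps of the 3-sphere\<close>

text \<open>\<open>nsphere 3\<close> consists of real sequences supported on the indices 0 to 3. The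
  two translations identify it with the unit sphere of pairs of complex numbers, the join of two
  circles.\<close>

definition nat_coords :: "complex \<times> complex \<Rightarrow> nat \<Rightarrow> real" where
  "nat_coords w = (\<lambda>i. if i = 0 then Re (fst w) else if i = 1 then Im (fst w)
     else if i = 2 then Re (snd w) else if i = 3 then Im (snd w) else 0)"

definition of_nat_coords :: "(nat \<Rightarrow> real) \<Rightarrow> complex \<times> complex" where
  "of_nat_coords v = (Complex (v 0) (v 1), Complex (v 2) (v 3))"

text \<open>Normalising with \<open>sgn\<close> gives every continuous map without zeros on the
  sphere a degree, and homotopies only have to avoid 0.\<close>

definition sphere_degree :: "(complex \<times> complex \<Rightarrow> complex \<times> complex) \<Rightarrow> int" where
  "sphere_degree f = Brouwer_degree2 3 (\<lambda>v. nat_coords (sgn (f (of_nat_coords v))))"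

lemma of_nat_coords_inverse [simp]: "of_nat_coords (nat_coords w) = w"
  by (simp add: of_nat_coords_def nat_coords_def)

lemma nsphere3_eq: "nsphere 3 = top_of_set (nat_coords ` sphere 0 1)"
proof -
  have sum4: "(\<Sum>i\<le>3. g i) = g 0 + g 1 + g 2 + g 3" for g :: "nat \<Rightarrow> real"
    by (simp add: eval_nat_numeral)
  have "{x. (\<Sum>i\<le>3. (x i)\<^sup>2) = 1 \<and> (\<forall>i>3. x i = (0::real))} = nat_coords ` sphere 0 1" (is "?A = ?B")
  proof (intro Set.set_eqI iffI)
    fix x :: "nat \<Rightarrow> real" assume x: "x \<in> ?A"
    have e: "x = nat_coords (of_nat_coords x)"
    proof
      fix i :: nat
      consider "i = 0" | "i = 1" | "i = 2" | "i = 3" | "i > 3" by linarith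
      then show "x i = nat_coords (of_nat_coords x) i"
        using x by cases (auto simp: nat_coords_def of_nat_coords_def)
    qed
    have "of_nat_coords x \<in> sphere 0 1"
      using x by (auto simp: of_nat_coords_def norm_prod_def norm_complex_def sum4)
    with e show "x \<in> ?B" by blast
  next
    fix x assume "x \<in> ?B"
    then show "x \<in> ?A"
      by (auto simp: nat_coords_def norm_prod_def norm_complex_def sum4)
  qed
  then show ?thesis
    by (simp add: nsphere euclidean_product_topology)
qed

lemma continuous_on_nat_coords: "continuous_on A nat_coords"
proof (intro continuous_on_coordinatewise_then_product)
  fix i
  show "continuous_on A (\<lambda>w. nat_coords w i)"
    unfolding nat_coords_def
    by (cases "i = 0"; cases "i = 1"; cases "i = 2"; cases "i = 3") (auto intro!: continuous_intros)
qed

lemma continuous_on_of_nat_coords: "continuous_on A of_nat_coords"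
proof -
  have p: "continuous_on A (\<lambda>v::nat \<Rightarrow> real. v i)" for i
    by (rule continuous_on_product_then_coordinatewise) (rule continuous_on_id)
  show ?thesis
    unfolding of_nat_coords_def Complex_eq by (intro continuous_intros p)
qed

lemma sphere_map_continuous_map:
  assumes "continuous_on (sphere 0 1) f" "\<And>w. w \<in> sphere 0 1 \<Longrightarrow> f w \<noteq> 0"
  shows "continuous_map (nsphere 3) (nsphere 3) (\<lambda>v. nat_coords (sgn (f (of_nat_coords v))))"
proof -
  have "continuous_on (sphere 0 1) (\<lambda>w. nat_coords (sgn (f w)))"
    unfolding sgn_div_norm
    by (intro continuous_on_compose2[OF continuous_on_nat_coords[of UNIV]] continuous_intros assms) (use assms in auto)
  then have "continuous_on (nat_coords ` sphere 0 1) (\<lambda>v. nat_coords (sgn (f (of_nat_coords v))))"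
    by (rule continuous_on_compose2[OF _ continuous_on_of_nat_coords]) auto
  moreover have "nat_coords (sgn (f w)) \<in> nat_coords ` sphere 0 1" if "w \<in> sphere 0 1" for w
    using assms(2)[OF that] by (intro imageI) (simp add: norm_sgn)
  ultimately show ?thesis
    by (auto simp: nsphere3_eq)
qed

lemma sphere_degree_homotopic:
  assumes cont: "continuous_on ({0..1} \<times> sphere 0 1) (\<lambda>(\<tau>, w). f \<tau> w)"
    and nz: "\<And>\<tau> w. \<lbrakk>0 \<le> \<tau>; \<tau> \<le> 1; norm w = 1\<rbrakk> \<Longrightarrow> f \<tau> w \<noteq> 0"
  shows "sphere_degree (f (0::real)) = sphere_degree (f 1)"
  unfolding sphere_degree_def
proof (rule Brouwer_degree2_homotopic)
  let ?h = "\<lambda>p. nat_coords (sgn (f (fst p) (of_nat_coords (snd p))))"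
  have c: "continuous_on ({0..1} \<times> sphere 0 1) (\<lambda>p. f (fst p) (snd p))"
    using cont by (simp add: case_prod_unfold)
  have "continuous_on ({0..1} \<times> sphere 0 1) (\<lambda>p. nat_coords (sgn (f (fst p) (snd p))))"
    unfolding sgn_div_norm
    by (intro continuous_on_compose2[OF continuous_on_nat_coords[of UNIV]] continuous_intros c) (use nz in auto)
  then have "continuous_on ({0..1} \<times> nat_coords ` sphere 0 1)
      (\<lambda>p. nat_coords (sgn (f (fst (fst p, of_nat_coords (snd p))) (snd (fst p, of_nat_coords (snd p))))))"
    by (rule continuous_on_compose2)
       (auto intro!: continuous_on_Pair continuous_on_fst continuous_on_id
          continuous_on_compose2[OF continuous_on_of_nat_coords continuous_on_snd])
  then have "continuous_on ({0..1} \<times> nat_coords ` sphere 0 1) ?h"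
    by simp
  moreover have "nat_coords (sgn (f t w)) \<in> nat_coords ` sphere 0 1"
    if "w \<in> sphere 0 1" "0 \<le> t" "t \<le> 1" for t w
    using nz[of t w] that by (intro imageI) (simp add: norm_sgn)
  ultimately show "homotopic_with (\<lambda>x. True) (nsphere 3) (nsphere 3)
     (\<lambda>v. nat_coords (sgn (f 0 (of_nat_coords v)))) (\<lambda>v. nat_coords (sgn (f 1 (of_nat_coords v))))"
    unfolding homotopic_with_def
    by (intro exI[of _ ?h]) (auto simp: nsphere3_eq)
qed

lemma sphere_degree_id: "sphere_degree id = 1"
proof -
  have "sphere_degree id = Brouwer_degree2 3 id"
    unfolding sphere_degree_def
    by (rule Brouwer_degree2_eq) (auto simp: nsphere3_eq sgn_div_norm)
  then show ?thesis by simp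
qed

text \<open>\<open>- cnj\<close> changes the sign of the real part only, which is coordinate 0 of
  the 3-sphere; this reflection has degree -1.\<close>

lemma sphere_degree_reflect:
  assumes "continuous_on (sphere 0 1) f" "\<And>w. w \<in> sphere 0 1 \<Longrightarrow> f w \<noteq> 0"
  shows "sphere_degree (\<lambda>w. (- cnj (fst (f w)), snd (f w))) = - sphere_degree f"
proof -
  let ?r = "\<lambda>x i. if i = (0::nat) then - x i else (x i :: real)"
  let ?f = "\<lambda>v. nat_coords (sgn (f (of_nat_coords v)))"
  have r: "continuous_map (nsphere 3) (nsphere 3) ?r"
    by (rule continuous_map_nsphere_reflection)
  have nr: "norm (- cnj x, y) = norm (x, y)" for x y :: complex
    by (simp add: norm_prod_def)
  have "nat_coords (sgn (- cnj (fst w), snd w)) = ?r (nat_coords (sgn w))" for w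
    by (cases w) (auto simp: nat_coords_def sgn_div_norm nr fun_eq_iff)
  then have "sphere_degree (\<lambda>w. (- cnj (fst (f w)), snd (f w))) = Brouwer_degree2 3 (?r \<circ> ?f)"
    by (simp add: sphere_degree_def o_def)
  also have "\<dots> = - sphere_degree f"
    by (subst Brouwer_degree2_compose[OF sphere_map_continuous_map[OF assms] r])
       (simp_all add: Brouwer_degree2_reflection sphere_degree_def)
  finally show ?thesis .
qed

lemma sphere_degree_nonsurjective:
  assumes f: "continuous_on (sphere 0 1) f" "\<And>w. w \<in> sphere 0 1 \<Longrightarrow> f w \<noteq> 0"
    and c: "norm c = 1" "\<And>w. norm w = 1 \<Longrightarrow> sgn (f w) \<noteq> c"
  shows "sphere_degree f = 0"
  unfolding sphere_degree_def
proof (rule Brouwer_degree2_nonsurjective[OF sphere_map_continuous_map[OF f]])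
  have "nat_coords c \<in> topspace (nsphere 3)"
    using c(1) by (simp add: nsphere3_eq)
  moreover have "nat_coords c \<noteq> nat_coords (sgn (f (of_nat_coords v)))" if "v \<in> topspace (nsphere 3)" for v
    using that c(2) by (auto simp: nsphere3_eq) (metis of_nat_coords_inverse)
  ultimately show "(\<lambda>v. nat_coords (sgn (f (of_nat_coords v)))) ` topspace (nsphere 3) \<noteq> topspace (nsphere 3)"
    by blast
qed

section \<open>Linking numbers\<close>

text \<open>The cone over a loop. It vanishes at the origin whatever \<open>Arg\<close> is there,
  and periodicity of the loop repairs the jump of \<open>Arg\<close> on the negative reals.\<close>

definition radial_extension :: "(real \<Rightarrow> real^3) \<Rightarrow> complex \<Rightarrow> real^3" where
  "radial_extension \<alpha> x = norm x *\<^sub>R \<alpha> (Arg x)"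

lemma periodic_int:
  assumes "\<And>t::real. f (t + 2 * pi) = f t"
  shows "f (t + 2 * pi * of_int k) = f t"
proof -
  have n: "f (t + 2 * pi * of_nat m) = f t" for t m
  proof (induction m)
    case (Suc m)
    have "t + 2 * pi * of_nat (Suc m) = (t + 2 * pi * of_nat m) + 2 * pi"
      by (simp add: algebra_simps)
    then show ?case using assms Suc by metis
  qed simp
  show ?thesis
  proof (cases "k \<ge> 0")
    case True
    then show ?thesis using n[of t "nat k"] by simp
  next
    case False
    then show ?thesis using n[of "t + 2 * pi * of_int k" "nat (- k)"] by simp
  qed
qed

lemma periodic_eq_if_cis_eq:
  assumes "\<And>t. f (t + 2 * pi) = f t" "cis s = cis t"
  shows "f s = f t"
proof -
  obtain k :: int where "s = t + 2 * pi * of_int k"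
    using assms(2) sin_cos_eq_iff[of s t] by (auto simp: complex_eq_iff)
  then show ?thesis
    using periodic_int[of f t k] assms(1) by simp
qed

text \<open>\<open>Arg\<close> is continuous off the nonpositive reals and \<open>Arg2pi\<close> off
  the nonnegative ones; periodicity makes both give the same value, and the two open sets cover
  everything but the origin. There a bound \<open>M\<close> for the loops, from compactness, forces
  the limit 0.\<close>

lemma radial_extension_continuous:
  fixes A :: "real \<Rightarrow> real \<Rightarrow> real^3"
  assumes cont: "continuous_on ({0..1} \<times> UNIV) (\<lambda>(\<tau>, t). A \<tau> t)"
    and per: "\<And>\<tau> t. A \<tau> (t + 2 * pi) = A \<tau> t"
  shows "continuous_on ({0..1} \<times> UNIV) (\<lambda>p. radial_extension (A (fst p)) (snd p))"
proof -
  let ?f = "\<lambda>p. radial_extension (A (fst p)) (snd p)"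
  have cA: "continuous_on T (\<lambda>p. A (g p) (k p))"
    if "continuous_on T g" "continuous_on T k" "g ` T \<subseteq> {0..1}" for T :: "(real \<times> complex) set" and g k
    using continuous_on_compose2[OF cont, of T "\<lambda>p. (g p, k p)"] that by (auto intro: continuous_on_Pair)
  have S: "continuous_on ({0..1} \<times> - \<real>\<^sub>\<le>\<^sub>0) ?f"
    unfolding radial_extension_def
    by (intro continuous_intros cA continuous_on_compose2[OF continuous_on_Arg]) auto
  have per2: "A \<tau> (Arg x) = A \<tau> (Arg2pi x)" if "x \<noteq> 0" for \<tau> x
  proof (rule periodic_eq_if_cis_eq[of "A \<tau>", OF per])
    have "of_real (norm x) * cis (Arg x) = of_real (norm x) * cis (Arg2pi x)"
      using Arg2pi_eq[of x] rcis_cmod_Arg[of x] by (simp add: rcis_def cis_conv_exp)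
    then show "cis (Arg x) = cis (Arg2pi x)"
      using that by simp
  qed
  have cArg2pi: "continuous_on (- \<real>\<^sub>\<ge>\<^sub>0) Arg2pi"
    by (simp add: continuous_at_Arg2pi continuous_at_imp_continuous_on)
  have "continuous_on ({0..1} \<times> - \<real>\<^sub>\<ge>\<^sub>0) (\<lambda>p. norm (snd p) *\<^sub>R A (fst p) (Arg2pi (snd p)))"
    by (intro continuous_intros cA continuous_on_compose2[OF cArg2pi]) auto
  then have T: "continuous_on ({0..1} \<times> - \<real>\<^sub>\<ge>\<^sub>0) ?f"
    by (rule continuous_on_eq) (auto simp: radial_extension_def per2)
  have un: "({0..1::real} \<times> - \<real>\<^sub>\<le>\<^sub>0) \<union> ({0..1} \<times> - \<real>\<^sub>\<ge>\<^sub>0) = {0..1} \<times> - {0::complex}"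
    by (auto simp: complex_nonneg_Reals_iff complex_nonpos_Reals_iff complex_eq_iff)
  have nz: "continuous_on ({0..1} \<times> - {0}) ?f"
    unfolding un[symmetric]
    by (rule continuous_on_Un_local_open[OF _ _ S T]; unfold un; rule openin_Times)
       (auto intro!: open_subset simp: open_Compl)
  obtain M where M: "\<And>\<tau> t. \<tau> \<in> {0..1} \<Longrightarrow> t \<in> {-pi..pi} \<Longrightarrow> norm (A \<tau> t) \<le> M"
  proof -
    have "compact ((\<lambda>(\<tau>, t). A \<tau> t) ` ({0..1} \<times> {-pi..pi}))"
      by (intro compact_continuous_image continuous_on_subset[OF cont] compact_Times compact_Icc) auto
    then obtain M where "\<forall>x \<in> (\<lambda>(\<tau>, t). A \<tau> t) ` ({0..1} \<times> {-pi..pi}). norm x \<le> M"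
      using compact_imp_bounded bounded_iff by metis
    then show ?thesis by (intro that[of M]) auto
  qed
  show ?thesis
    unfolding continuous_on_eq_continuous_within
  proof
    fix p assume p: "p \<in> {0..1::real} \<times> (UNIV :: complex set)"
    obtain \<tau> x where px: "p = (\<tau>, x)" by (cases p)
    show "continuous (at p within {0..1} \<times> UNIV) ?f"
    proof (cases "x = 0")
      case False
      have "at p within {0..1} \<times> UNIV = at p within {0..1} \<times> - {0}"
        by (rule at_within_nhd[of _ "UNIV \<times> - {0}"]) (use False px in \<open>auto intro: open_Times\<close>)
      then show ?thesis
        using nz p False px by (simp add: continuous_on_eq_continuous_within)
    next
      case True
      have "((\<lambda>p. M * norm (snd p)) \<longlongrightarrow> M * norm (snd p)) (at p within {0..1} \<times> UNIV)"
        by (intro tendsto_intros)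
      then have 1: "((\<lambda>p. M * norm (snd p)) \<longlongrightarrow> 0) (at p within {0..1} \<times> UNIV)"
        using True px by simp
      have "norm (?f q) \<le> M * norm (snd q)" if "q \<in> {0..1} \<times> UNIV" for q
      proof -
        have "norm (A (fst q) (Arg (snd q))) \<le> M"
          using that Arg_bounded[of "snd q"] by (intro M) auto
        then have "norm (snd q) * norm (A (fst q) (Arg (snd q))) \<le> norm (snd q) * M"
          by (intro mult_left_mono) auto
        then show ?thesis
          by (simp add: radial_extension_def mult.commute)
      qed
      then have "\<forall>\<^sub>F q in at p within {0..1} \<times> UNIV. norm (?f q) \<le> M * norm (snd q)"
        by (auto simp: eventually_at_filter)
      from Lim_null_comparison[OF this 1] show ?thesis
        using True px by (simp add: continuous_within radial_extension_def)
    qed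
  qed
qed

lemma radial_extension_continuous_single:
  assumes "continuous_on UNIV \<alpha>" "\<And>t. \<alpha> (t + 2 * pi) = \<alpha> t"
  shows "continuous_on S (radial_extension \<alpha>)"
proof -
  have "continuous_on ({0..1::real} \<times> UNIV) (\<lambda>p. radial_extension \<alpha> (snd p))"
    by (rule radial_extension_continuous[of "\<lambda>_. \<alpha>"])
       (use assms in \<open>auto simp: case_prod_unfold intro!: continuous_on_compose2[OF assms(1)] continuous_intros\<close>)
  then have "continuous_on S (\<lambda>x. radial_extension \<alpha> (snd (0::real, x)))"
    by (rule continuous_on_compose2) (auto intro: continuous_intros)
  then show ?thesis by simp
qed

text \<open>This is, up to homotopy, the Hopf construction applied to the map from the torus to the punctured
  space that sends \<open>(s, t)\<close> to \<open>\<alpha> s - \<beta> t\<close>. It turns linking numbers into degrees of maps of the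
  3-sphere.\<close>

definition link_map :: "(real \<Rightarrow> real^3) \<Rightarrow> (real \<Rightarrow> real^3) \<Rightarrow> complex \<times> complex \<Rightarrow> complex \<times> complex" where
  "link_map \<alpha> \<beta> w = (let d = radial_extension \<alpha> (fst w) - radial_extension \<beta> (snd w)
     in (Complex (d $ 3) (norm (fst w) - norm (snd w)), Complex (d $ 1) (d $ 2)))"

definition linking_number :: "(real \<Rightarrow> real^3) \<Rightarrow> (real \<Rightarrow> real^3) \<Rightarrow> int" where
  "linking_number \<alpha> \<beta> = sphere_degree (link_map \<alpha> \<beta>)"

text \<open>At a zero the two radii agree, and they are positive on the sphere; the remaining
  coordinates are this common radius times a difference
  \<open>\<alpha> s - \<beta> t\<close>.\<close>

lemma link_map_nonzero:
  assumes "\<And>s t. \<alpha> s \<noteq> \<beta> t" "norm w = 1"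
  shows "link_map \<alpha> \<beta> w \<noteq> 0"
proof
  assume z: "link_map \<alpha> \<beta> w = 0"
  then have n: "norm (fst w) = norm (snd w)"
    by (auto simp: link_map_def Let_def zero_prod_def complex_eq_iff)
  have "norm (fst w) *\<^sub>R (\<alpha> (Arg (fst w)) - \<beta> (Arg (snd w))) = 0"
    using z n unfolding link_map_def Let_def radial_extension_def
    by (simp add: zero_prod_def complex_eq_iff vec_eq_iff forall_3 algebra_simps) auto
  then have "fst w = 0"
    using assms(1) by simp
  with n assms(2) show False
    by (cases w) (auto simp: norm_prod_def)
qed

text \<open>\<open>link_map\<close> only sees differences between the two loops, so either loop may
  cross itself on the way.\<close>

lemma linking_number_homotopic:
  fixes A B :: "real \<Rightarrow> real \<Rightarrow> real^3"
  assumes "continuous_on ({0..1} \<times> UNIV) (\<lambda>(\<tau>, t). A \<tau> t)" "continuous_on ({0..1} \<times> UNIV) (\<lambda>(\<tau>, t). B \<tau> t)"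
    and "\<And>\<tau> t. A \<tau> (t + 2 * pi) = A \<tau> t" "\<And>\<tau> t. B \<tau> (t + 2 * pi) = B \<tau> t"
    and ne: "\<And>\<tau> s t. 0 \<le> \<tau> \<Longrightarrow> \<tau> \<le> 1 \<Longrightarrow> A \<tau> s \<noteq> B \<tau> t"
  shows "linking_number (A 0) (B 0) = linking_number (A 1) (B 1)"
  unfolding linking_number_def
proof (rule sphere_degree_homotopic)
  let ?S = "{0..1::real} \<times> sphere (0::complex \<times> complex) 1"
  have a: "continuous_on ?S (\<lambda>p. radial_extension (A (fst p)) (fst (snd p)))"
    using continuous_on_compose2[OF radial_extension_continuous[OF assms(1,3)], of ?S "\<lambda>p. (fst p, fst (snd p))"]
    by (force intro: continuous_intros)
  have b: "continuous_on ?S (\<lambda>p. radial_extension (B (fst p)) (snd (snd p)))"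
    using continuous_on_compose2[OF radial_extension_continuous[OF assms(2,4)], of ?S "\<lambda>p. (fst p, snd (snd p))"]
    by (force intro: continuous_intros)
  show "continuous_on ?S (\<lambda>(\<tau>, w). link_map (A \<tau>) (B \<tau>) w)"
    unfolding link_map_def Let_def case_prod_unfold Complex_eq
    by (intro continuous_intros a b)
qed (rule link_map_nonzero[OF ne])

lemma link_map_continuous:
  assumes "continuous_on UNIV \<alpha>" "continuous_on UNIV \<beta>"
    and "\<And>t. \<alpha> (t + 2 * pi) = \<alpha> t" "\<And>t. \<beta> (t + 2 * pi) = \<beta> t"
  shows "continuous_on S (link_map \<alpha> \<beta>)"
  unfolding link_map_def Let_def Complex_eq
  by (intro continuous_intros continuous_on_compose2[OF radial_extension_continuous_single[of _ UNIV]] assms) auto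

text \<open>\<open>link_map\<close> stores the third coordinate of the difference as a real part, so
  mirroring both loops becomes the reflection of \<open>sphere_degree_reflect\<close>.\<close>

lemma linking_number_mirror:
  assumes "continuous_on UNIV \<alpha>" "continuous_on UNIV \<beta>"
    and "\<And>t. \<alpha> (t + 2 * pi) = \<alpha> t" "\<And>t. \<beta> (t + 2 * pi) = \<beta> t" "\<And>s t. \<alpha> s \<noteq> \<beta> t"
  shows "linking_number (mirror \<circ> \<alpha>) (mirror \<circ> \<beta>) = - linking_number \<alpha> \<beta>"
proof -
  have "link_map (mirror \<circ> \<alpha>) (mirror \<circ> \<beta>) = (\<lambda>w. (- cnj (fst (link_map \<alpha> \<beta> w)), snd (link_map \<alpha> \<beta> w)))"
    by (auto simp: link_map_def Let_def radial_extension_def mirror_def complex_eq_iff algebra_simps)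
  then show ?thesis
    unfolding linking_number_def
    using sphere_degree_reflect[OF link_map_continuous[OF assms(1-4)] link_map_nonzero] assms(5) by simp
qed

text \<open>Reversing both loops reflects two coordinates of the 3-sphere, which is a rotation.\<close>

lemma linking_number_reverse:
  assumes "continuous_on UNIV \<alpha>" "continuous_on UNIV \<beta>"
    and "\<And>t. \<alpha> (t + 2 * pi) = \<alpha> t" "\<And>t. \<beta> (t + 2 * pi) = \<beta> t" "\<And>s t. \<alpha> s \<noteq> \<beta> t"
  shows "linking_number (\<lambda>t. \<alpha> (- t)) (\<lambda>t. \<beta> (- t)) = linking_number \<alpha> \<beta>"
proof -
  have cnj: "radial_extension (\<lambda>t. \<gamma> (- t)) x = radial_extension \<gamma> (cnj x)"
    if "\<And>t. \<gamma> (t + 2 * pi) = \<gamma> t" for \<gamma> x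
  proof (cases "x = 0")
    case False
    then have "cis (- Arg x) = cis (Arg (cnj x))"
      by (simp add: cis_Arg cis_cnj[symmetric] sgn_div_norm)
    from periodic_eq_if_cis_eq[of \<gamma>, OF that this] show ?thesis
      by (simp add: radial_extension_def)
  qed (simp add: radial_extension_def)
  \<comment> \<open>Rotation by \<open>\<tau> * pi\<close> in the plane of the two imaginary parts;
    it ends at conjugation of both components.\<close>
  define \<rho> where "\<rho> \<tau> w = (Complex (Re (fst w)) (cos (\<tau> * pi) * Im (fst w) - sin (\<tau> * pi) * Im (snd w)),
     Complex (Re (snd w)) (sin (\<tau> * pi) * Im (fst w) + cos (\<tau> * pi) * Im (snd w)))" for \<tau> w
  have \<rho>: "norm (\<rho> \<tau> w) = norm w" for \<tau> w
  proof -
    have "(c * x - s * y)\<^sup>2 + (s * x + c * y)\<^sup>2 = x\<^sup>2 + y\<^sup>2" if "s\<^sup>2 + c\<^sup>2 = 1" for c s x y :: real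
    proof -
      have "(c * x - s * y)\<^sup>2 + (s * x + c * y)\<^sup>2 = (s\<^sup>2 + c\<^sup>2) * (x\<^sup>2 + y\<^sup>2)"
        by (simp add: power2_eq_square algebra_simps)
      with that show ?thesis by simp
    qed
    from this[OF sin_cos_squared_add, of "\<tau> * pi" "Im (fst w)" "Im (snd w)"] show ?thesis
      unfolding \<rho>_def by (simp add: norm_prod_def cmod_def algebra_simps)
  qed
  have "sphere_degree (\<lambda>w. link_map \<alpha> \<beta> (\<rho> 0 w)) = sphere_degree (\<lambda>w. link_map \<alpha> \<beta> (\<rho> 1 w))"
  proof (rule sphere_degree_homotopic[where f = "\<lambda>\<tau> w. link_map \<alpha> \<beta> (\<rho> \<tau> w)"])
    show "continuous_on ({0..1} \<times> sphere 0 1) (\<lambda>(\<tau>, w). link_map \<alpha> \<beta> (\<rho> \<tau> w))"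
      unfolding case_prod_unfold
      by (intro continuous_on_compose2[OF link_map_continuous[OF assms(1-4), of UNIV]])
         (auto simp: \<rho>_def Complex_eq intro!: continuous_intros)
  qed (rule link_map_nonzero[OF assms(5)], simp add: \<rho>)
  moreover have "\<rho> 0 w = w" for w
    by (simp add: \<rho>_def)
  moreover have "\<rho> 1 w = (cnj (fst w), cnj (snd w))" for w
    by (simp add: \<rho>_def complex_eq_iff)
  moreover have "link_map (\<lambda>t. \<alpha> (- t)) (\<lambda>t. \<beta> (- t)) = (\<lambda>w. link_map \<alpha> \<beta> (cnj (fst w), cnj (snd w)))"
    by (auto simp: link_map_def cnj assms)
  ultimately show ?thesis
    by (simp add: linking_number_def)
qed

text \<open>Seen along the first axis, the first loop is never in front of the second. So their
  difference never points in the positive direction of that axis, and the normalised map omits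
  \<open>(0, 1)\<close>.\<close>

lemma linking_number_eq_0:
  assumes "continuous_on UNIV \<alpha>" "continuous_on UNIV \<beta>"
    and "\<And>t. \<alpha> (t + 2 * pi) = \<alpha> t" "\<And>t. \<beta> (t + 2 * pi) = \<beta> t" "\<And>s t. \<alpha> s \<noteq> \<beta> t"
    and miss: "\<And>s t. \<alpha> s $ 2 = \<beta> t $ 2 \<Longrightarrow> \<alpha> s $ 3 = \<beta> t $ 3 \<Longrightarrow> \<alpha> s $ 1 \<le> \<beta> t $ 1"
  shows "linking_number \<alpha> \<beta> = 0"
  unfolding linking_number_def
proof (rule sphere_degree_nonsurjective[OF link_map_continuous[OF assms(1-4)] link_map_nonzero])
  show "norm (0 :: complex, 1 :: complex) = 1"
    by (simp add: norm_prod_def)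
  show "sgn (link_map \<alpha> \<beta> w) \<noteq> (0, 1)" for w
  proof
    let ?x = "fst w" and ?y = "snd w"
    let ?d = "radial_extension \<alpha> ?x - radial_extension \<beta> ?y"
    assume e: "sgn (link_map \<alpha> \<beta> w) = (0, 1)"
    define m where "m = norm (link_map \<alpha> \<beta> w)"
    have "(0 :: complex, 1 :: complex) \<noteq> 0" by (simp add: zero_prod_def)
    then have "link_map \<alpha> \<beta> w \<noteq> 0" using e by (metis sgn_zero)
    then have m: "m > 0" by (simp add: m_def)
    have "link_map \<alpha> \<beta> w = m *\<^sub>R sgn (link_map \<alpha> \<beta> w)"
      using m by (simp add: sgn_div_norm m_def)
    then have l: "link_map \<alpha> \<beta> w = (0, of_real m)"
      by (simp add: e scaleR_conv_of_real)
    then have n: "norm ?x = norm ?y" and d: "?d $ 3 = 0" "?d $ 2 = 0" "?d $ 1 = m"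
      by (auto simp: link_map_def Let_def complex_eq_iff)
    have d': "?d = norm ?x *\<^sub>R (\<alpha> (Arg ?x) - \<beta> (Arg ?y))"
      by (simp add: radial_extension_def n algebra_simps)
    then have x: "norm ?x > 0"
      using d m by auto
    have "\<alpha> (Arg ?x) $ 1 \<le> \<beta> (Arg ?y) $ 1"
      using d x unfolding d' by (intro miss) auto
    then have "?d $ 1 \<le> 0"
      unfolding d' using x by (simp add: mult_le_0_iff)
    with d m show False by simp
  qed
qed (use assms in auto)

text \<open>A Hopf link chosen for computation: an ellipse in the plane orthogonal to the first
  axis, centred at the point (0, -2, 0) of a round circle. The radial extensions are then linear
  except for the term \<open>2 * norm x\<close>.\<close>

lemma linking_number_hopf:
  "linking_number (\<lambda>s. vector [0, 2 * sin s - 2, cos s]) (\<lambda>t. vector [2 * cos t, 2 * sin t, 0]) = 1"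
proof -
  have re: "norm x * cos (Arg x) = Re x" "norm x * sin (Arg x) = Im x" for x
    using rcis_cmod_Arg[of x] by (metis Re_rcis, metis Im_rcis)
  let ?F = "\<lambda>w. (Complex (Re (fst w)) (norm (fst w) - norm (snd w)),
     Complex (- 2 * Re (snd w)) (2 * Im (fst w) - 2 * norm (fst w) - 2 * Im (snd w)))"
  have "radial_extension (\<lambda>s. vector [0, 2 * sin s - 2, cos s]) x = vector [0, 2 * Im x - 2 * norm x, Re x]" for x
  proof -
    have "norm x * (2 * sin (Arg x) - 2) = 2 * (norm x * sin (Arg x)) - 2 * norm x"
      by (simp add: algebra_simps)
    then show ?thesis
      by (simp only: re radial_extension_def) (simp add: vec_eq_iff forall_3 re)
  qed
  moreover have "radial_extension (\<lambda>t. vector [2 * cos t, 2 * sin t, 0]) x = vector [2 * Re x, 2 * Im x, 0]" for x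
  proof -
    have "norm x * (2 * sin (Arg x)) = 2 * (norm x * sin (Arg x))" "norm x * (2 * cos (Arg x)) = 2 * (norm x * cos (Arg x))"
      by simp_all
    then show ?thesis
      by (simp only: re radial_extension_def) (simp add: vec_eq_iff forall_3)
  qed
  ultimately have F: "link_map (\<lambda>s. vector [0, 2 * sin s - 2, cos s]) (\<lambda>t. vector [2 * cos t, 2 * sin t, 0]) = ?F"
    by (intro ext) (simp add: link_map_def Let_def)
  \<comment> \<open>A straight-line homotopy to \<open>(fst w, - snd w)\<close>, which a half turn
    of the second component joins to the identity.\<close>
  define f where "f \<tau> w = (1 - \<tau>) *\<^sub>R ?F w + \<tau> *\<^sub>R (fst w, - snd w)" for \<tau> w
  have "sphere_degree (f 0) = sphere_degree (f 1)"
  proof (rule sphere_degree_homotopic)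
    show "continuous_on ({0..1} \<times> sphere 0 1) (\<lambda>(\<tau>, w). f \<tau> w)"
      unfolding f_def case_prod_unfold Complex_eq by (intro continuous_intros)
    show "f \<tau> w \<noteq> 0" if \<tau>: "0 \<le> \<tau>" "\<tau> \<le> 1" and w: "norm w = 1" for \<tau> w
    proof
      assume "f \<tau> w = 0"
      then have e: "(1 - \<tau>) * Re (fst w) + \<tau> * Re (fst w) = 0"
        "(1 - \<tau>) * (norm (fst w) - norm (snd w)) + \<tau> * Im (fst w) = 0"
        "(1 - \<tau>) * (- 2 * Re (snd w)) - \<tau> * Re (snd w) = 0"
        "(1 - \<tau>) * (2 * Im (fst w) - 2 * norm (fst w) - 2 * Im (snd w)) - \<tau> * Im (snd w) = 0"
        by (auto simp: f_def zero_prod_def complex_eq_iff)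
      define p q where "p = Im (fst w)" and "q = Im (snd w)"
      have x1: "Re (fst w) = 0" using e(1) by (simp add: algebra_simps)
      have "(\<tau> - 2) * Re (snd w) = 0" using e(3) by (simp add: algebra_simps)
      then have y1: "Re (snd w) = 0" using \<tau> by simp
      have n: "norm (fst w) = \<bar>p\<bar>" "norm (snd w) = \<bar>q\<bar>"
        by (simp_all add: cmod_def x1 y1 p_def q_def)
      have e1: "(1 - \<tau>) * (\<bar>p\<bar> - \<bar>q\<bar>) + \<tau> * p = 0" and e2: "(1 - \<tau>) * (2 * p - 2 * \<bar>p\<bar> - 2 * q) - \<tau> * q = 0"
        using e(2,4) unfolding n p_def q_def by auto
      have "p = 0 \<and> q = 0"
      proof (cases "p \<ge> 0")
        case True
        then have "(\<tau> - 2) * q = 0" using e2 by (simp add: algebra_simps)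
        then have "q = 0" using \<tau> by simp
        with e1 True show ?thesis by (simp add: algebra_simps)
      next
        case False
        then have p: "p < 0" by simp
        \<comment> \<open>Eliminating \<open>q\<close> leaves \<open>p\<close> times a quadratic
          polynomial in \<open>\<tau>\<close> with negative discriminant.\<close>
        have e3: "(2 - \<tau>) * q = 4 * (1 - \<tau>) * p" using e2 p by (simp add: algebra_simps)
        have "(2 - \<tau>) * q \<le> 0" unfolding e3 using p \<tau> by (simp add: mult_le_0_iff)
        then have "q \<le> 0" using \<tau> by (simp add: mult_le_0_iff)
        then have "(1 - \<tau>) * (q - p) + \<tau> * p = 0" using e1 p by simp
        then have "(2 - \<tau>) * ((1 - \<tau>) * (q - p) + \<tau> * p) = 0" by simp
        then have "(1 - \<tau>) * ((2 - \<tau>) * q) - (2 - \<tau>) * (1 - \<tau>) * p + (2 - \<tau>) * \<tau> * p = 0"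
          by (simp add: algebra_simps)
        then have "p * (2 * \<tau>^2 - 3 * \<tau> + 2) = 0"
          unfolding e3 by (simp add: algebra_simps power2_eq_square)
        moreover have "2 * \<tau>^2 - 3 * \<tau> + 2 > 0"
        proof -
          have "2 * \<tau>^2 - 3 * \<tau> + 2 = 2 * (\<tau> - 3/4)^2 + 7/8" by (simp add: power2_eq_square algebra_simps)
          then show ?thesis using zero_le_power2[of "\<tau> - 3/4"] by linarith
        qed
        ultimately show ?thesis using p by simp
      qed
      then show False
        using w n by (cases w) (auto simp: norm_prod_def)
    qed
  qed
  moreover have "sphere_degree (f 1) = 1"
  proof -
    let ?g = "\<lambda>\<tau> w :: complex \<times> complex. (fst w, - (cis (pi * \<tau>) * snd w))"
    have "sphere_degree (?g 0) = sphere_degree (?g 1)"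
    proof (rule sphere_degree_homotopic)
      show "continuous_on ({0..1} \<times> sphere 0 1) (\<lambda>(\<tau>, w). ?g \<tau> w)"
        unfolding case_prod_unfold cis_conv_exp by (intro continuous_intros)
    qed (auto simp: zero_prod_def prod_eq_iff)
    moreover have "?g 1 = id" "?g 0 = f 1"
      by (auto simp: f_def)
    ultimately show ?thesis
      by (simp only: sphere_degree_id)
  qed
  moreover have "f 0 = ?F"
    by (auto simp: f_def)
  ultimately show ?thesis
    unfolding linking_number_def F by simp
qed

section \<open>Loops in the annulus\<close>

text \<open>The coordinate \<open>u\<close> runs along the normal of the annulus; \<open>(t, s, u)\<close> are coordinates of a solid
  torus around it.\<close>

definition torus_point :: "real \<Rightarrow> real \<Rightarrow> real \<Rightarrow> real \<Rightarrow> real^3" where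
  "torus_point e t s u = vector [(2 + s * cos t - u * sin t) * cos t, (2 + s * cos t - u * sin t) * sin t,
     e * (s * sin t + u * cos t)]"

lemma annulus_point_eq_torus_point: "annulus_point e t s = torus_point e t s 0"
  by (simp add: annulus_point_def torus_point_def mult.assoc)

lemma torus_point_cis_cong:
  assumes "cis t = cis t'"
  shows "torus_point e t s u = torus_point e t' s u"
  using assms by (simp add: torus_point_def complex_eq_iff)

lemma mirror_torus_point: "mirror (torus_point e t s u) = torus_point (- e) t s u"
  by (simp add: mirror_def torus_point_def)

lemma abs_mult_trig_le: "\<bar>s * cos t\<bar> \<le> \<bar>s\<bar>" "\<bar>s * sin t\<bar> \<le> \<bar>s\<bar>" for s t :: real
  by (simp_all add: abs_mult mult_left_le)

lemma torus_radius_pos: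
  fixes s u t :: real
  assumes "\<bar>s\<bar> + \<bar>u\<bar> < 2"
  shows "2 + s * cos t - u * sin t > 0"
  using abs_mult_trig_le[of s t] abs_mult_trig_le[of u t] assms by linarith

lemma rotation_inj:
  fixes x y x' y' c s :: real
  assumes "x * c - y * s = x' * c - y' * s" "x * s + y * c = x' * s + y' * c" "c\<^sup>2 + s\<^sup>2 = 1"
  shows "x = x'" "y = y'"
proof -
  have x: "(c\<^sup>2 + s\<^sup>2) * x = (x * c - y * s) * c + (x * s + y * c) * s"
    and y: "(c\<^sup>2 + s\<^sup>2) * y = (x * s + y * c) * c - (x * c - y * s) * s" for x y
    by (simp_all add: power2_eq_square algebra_simps)
  show "x = x'" using x[of x y] x[of x' y'] assms by simp
  show "y = y'" using y[of y x] y[of y' x'] assms by simp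
qed

text \<open>The bound keeps the distance \<open>\<rho>\<close> from the vertical axis positive, so
  the point determines the angle. Up to the sign \<open>e\<close>, the pair of
  \<open>\<rho> - 2\<close> and the height is \<open>(s, u)\<close> rotated by this angle.\<close>

lemma torus_point_inj:
  assumes e: "e \<in> {-1, 1::real}" and s: "\<bar>s\<bar> + \<bar>u\<bar> < 2" "\<bar>s'\<bar> + \<bar>u'\<bar> < 2"
    and eq: "torus_point e t s u = torus_point e t' s' u'"
  shows "cis t = cis t'" "s = s'" "u = u'"
proof -
  define \<rho> where "\<rho> = 2 + s * cos t - u * sin t"
  define \<rho>' where "\<rho>' = 2 + s' * cos t' - u' * sin t'"
  have pos: "\<rho> > 0" "\<rho>' > 0"
    using torus_radius_pos s by (auto simp: \<rho>_def \<rho>'_def)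
  have c: "\<rho> * cos t = \<rho>' * cos t'" "\<rho> * sin t = \<rho>' * sin t'"
    and z: "s * sin t + u * cos t = s' * sin t' + u' * cos t'"
    using eq e by (auto simp: torus_point_def vec_eq_iff forall_3 \<rho>_def \<rho>'_def)
  have "\<rho>\<^sup>2 * ((cos t)\<^sup>2 + (sin t)\<^sup>2) = \<rho>'\<^sup>2 * ((cos t')\<^sup>2 + (sin t')\<^sup>2)"
    using c by (metis distrib_left power_mult_distrib)
  then have r: "\<rho> = \<rho>'"
    using pos by (simp add: power2_eq_iff)
  with c pos have cs: "cos t = cos t'" "sin t = sin t'" by auto
  then show "cis t = cis t'" by (simp add: complex_eq_iff)
  have r': "s * cos t - u * sin t = s' * cos t - u' * sin t"
    using r unfolding \<rho>_def \<rho>'_def cs by simp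
  have "s * sin t + u * cos t = s' * sin t + u' * cos t"
    using z unfolding cs .
  from rotation_inj[OF r' this sin_cos_squared_add2] show "s = s'" "u = u'"
    by simp_all
qed

lemma annulus_point_eq_iff:
  assumes "e \<in> {-1, 1}" "\<bar>s\<bar> \<le> 1" "\<bar>s'\<bar> \<le> 1"
  shows "annulus_point e t s = annulus_point e t' s' \<longleftrightarrow> cis t = cis t' \<and> s = s'"
  using torus_point_inj[OF assms(1), of s 0 s' 0 t t'] torus_point_cis_cong[of t t' e] assms(2,3)
  by (auto simp: annulus_point_eq_torus_point)

text \<open>A loop in annulus coordinates: \<open>\<theta>\<close> lifts its angle to the real line,
  and \<open>a\<close> is its winding number around the core.\<close>

definition annular_loop :: "(real \<Rightarrow> real) \<Rightarrow> (real \<Rightarrow> real) \<Rightarrow> int \<Rightarrow> bool" where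
  "annular_loop \<theta> r a \<longleftrightarrow> continuous_on UNIV \<theta> \<and> continuous_on UNIV r \<and>
     (\<forall>t. \<theta> (t + 2 * pi) = \<theta> t + 2 * pi * of_int a) \<and> (\<forall>t. r (t + 2 * pi) = r t) \<and> (\<forall>t. \<bar>r t\<bar> \<le> 1)"

lemma cis_eq_imp_diff: "cis x = cis y \<Longrightarrow> \<exists>k::int. x = y + 2 * pi * of_int k"
  using sin_cos_eq_iff[of x y] by (auto simp: complex_eq_iff)

lemma cis_add_2pi_int [simp]: "cis (x + 2 * pi * of_int k) = cis x"
  by (rule periodic_int) (simp add: complex_eq_iff)

text \<open>The horizontal projection of the loop avoids the origin, so it has a continuous
  logarithm on the line, whose imaginary part is the lifted angle.\<close>

lemma annular_loop_lift:
  assumes e: "e \<in> {-1, 1}" and cont: "continuous_on UNIV \<alpha>" and per: "\<And>t. \<alpha> (t + 2 * pi) = \<alpha> t"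
    and ann: "\<And>t. \<exists>\<phi> s. \<bar>s\<bar> \<le> 1 \<and> \<alpha> t = annulus_point e \<phi> s"
  obtains \<theta> r a where "annular_loop \<theta> r a" "\<And>t. \<alpha> t = annulus_point e (\<theta> t) (r t)"
proof -
  define z where "z t = Complex (\<alpha> t $ 1) (\<alpha> t $ 2)" for t
  have z: "z t = of_real (2 + s * cos \<phi>) * cis \<phi>" if "\<alpha> t = annulus_point e \<phi> s" for t \<phi> s
    using that by (simp add: z_def annulus_point_def complex_eq_iff)
  have zpos: "2 + s * cos \<phi> > 0" if "\<bar>s\<bar> \<le> 1" for s \<phi> :: real
    using torus_radius_pos[of s 0 \<phi>] that by simp
  have "z t \<noteq> 0" for t
    using ann[of t] z[of t] zpos by (metis cis_neq_zero mult_eq_0_iff of_real_eq_0_iff less_irrefl)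
  moreover have cz: "continuous_on UNIV z"
    unfolding z_def Complex_eq by (intro continuous_intros cont)
  ultimately obtain g where g: "continuous_on UNIV g" "\<And>t. z t = exp (g t)"
    using continuous_logarithm_on_contractible[of UNIV z] by (metis UNIV_I contractible_UNIV)
  define \<theta> where "\<theta> t = Im (g t)" for t
  \<comment> \<open>The displacement from the core, projected to the direction of the s-axis at the
    angle \<open>\<theta> t\<close>; it recovers \<open>s\<close> because
    \<open>e * e = 1\<close>.\<close>
  define r where "r t = (norm (z t) - 2) * cos (\<theta> t) + e * \<alpha> t $ 3 * sin (\<theta> t)" for t
  have main: "cis (\<theta> t) = cis \<phi> \<and> r t = s" if s: "\<bar>s\<bar> \<le> 1" and \<alpha>: "\<alpha> t = annulus_point e \<phi> s" for t \<phi> s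
  proof -
    have n: "norm (z t) = 2 + s * cos \<phi>"
      unfolding z[OF \<alpha>] using zpos[OF s, of \<phi>]
      by (simp only: norm_mult norm_cis norm_of_real mult_1_right abs_of_pos)
    have "of_real (norm (z t)) * cis (\<theta> t) = z t"
      by (simp add: g(2) \<theta>_def exp_eq_polar[of "g t"] norm_mult flip: exp_of_real)
    then have c: "cis (\<theta> t) = cis \<phi>"
      unfolding n using z[OF \<alpha>] zpos[OF s, of \<phi>] by (metis less_irrefl mult_left_cancel of_real_eq_0_iff)
    then have "cos (\<theta> t) = cos \<phi>" "sin (\<theta> t) = sin \<phi>"
      by (simp_all add: complex_eq_iff)
    moreover have "\<alpha> t $ 3 = e * s * sin \<phi>"
      by (simp add: \<alpha> annulus_point_def)
    ultimately have "r t = s * ((cos \<phi>)\<^sup>2 + (e * e) * (sin \<phi>)\<^sup>2)"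
      unfolding r_def n by (simp add: power2_eq_square algebra_simps)
    also have "\<dots> = s" using e by auto
    finally show ?thesis using c by simp
  qed
  have \<alpha>: "\<alpha> t = annulus_point e (\<theta> t) (r t)" and r1: "\<bar>r t\<bar> \<le> 1" for t
  proof -
    obtain \<phi> s where s: "\<bar>s\<bar> \<le> 1" "\<alpha> t = annulus_point e \<phi> s" using ann by blast
    with main[OF s] show "\<alpha> t = annulus_point e (\<theta> t) (r t)" "\<bar>r t\<bar> \<le> 1"
      by (simp_all add: annulus_point_eq_torus_point torus_point_cis_cong[of "\<theta> t" \<phi>])
  qed
  have c\<theta>: "continuous_on UNIV \<theta>"
    unfolding \<theta>_def by (intro continuous_intros g(1))
  have cr: "continuous_on UNIV r"
    unfolding r_def by (intro continuous_intros c\<theta> cz cont)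
  have shift: "cis (\<theta> (t + 2 * pi)) = cis (\<theta> t)" "r (t + 2 * pi) = r t" for t
    using main[OF r1[of t], of "t + 2 * pi" "\<theta> t"] \<alpha>[of t] per[of t] by auto
  \<comment> \<open>The number of turns per period is continuous in \<open>t\<close> and an integer,
    hence constant.\<close>
  define k where "k t = (\<theta> (t + 2 * pi) - \<theta> t) / (2 * pi)" for t
  have k: "k t \<in> \<int>" for t
    using cis_eq_imp_diff[OF shift(1)[of t]] by (auto simp: k_def)
  have "k constant_on UNIV"
  proof (rule continuous_discrete_range_constant)
    show "continuous_on UNIV k"
      unfolding k_def by (intro continuous_intros continuous_on_compose2[OF c\<theta>]) auto
    show "\<exists>\<epsilon>>0. \<forall>y. y \<in> UNIV \<and> k y \<noteq> k x \<longrightarrow> \<epsilon> \<le> norm (k y - k x)" for x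
    proof (intro exI[of _ "1::real"] conjI allI impI)
      fix y assume "y \<in> UNIV \<and> k y \<noteq> k x"
      moreover obtain i j :: int where "k x = of_int i" "k y = of_int j"
        using k by (metis Ints_cases)
      ultimately show "1 \<le> norm (k y - k x)"
        by (simp add: abs_if)
    qed simp
  qed simp
  then obtain c where c: "\<And>t. k t = c" by (auto simp: constant_on_def)
  then obtain a :: int where "c = of_int a" using k by (metis Ints_cases)
  then have "\<theta> (t + 2 * pi) = \<theta> t + 2 * pi * of_int a" for t
    using c[of t] by (simp add: k_def field_simps)
  then have "annular_loop \<theta> r a"
    using c\<theta> cr shift r1 by (simp add: annular_loop_def)
  then show thesis using \<alpha> by (rule that)
qed

text \<open>Pushing the first loop off the annulus keeps the two loops disjoint, whatever happens to them
  within the annulus afterwards, so a single homotopy can move both loops to the core and make their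
  angles linear.\<close>

lemma linking_number_annular_loops:
  assumes e: "e \<in> {-1, 1}" and 1: "annular_loop \<theta> r a" and 2: "annular_loop \<theta>' r' b"
    and ne: "\<And>s t. annulus_point e (\<theta> s) (r s) \<noteq> annulus_point e (\<theta>' t) (r' t)"
  shows "linking_number (\<lambda>t. annulus_point e (\<theta> t) (r t)) (\<lambda>t. annulus_point e (\<theta>' t) (r' t)) =
    linking_number (\<lambda>t. torus_point e (of_int a * t) 0 (1/2)) (\<lambda>t. torus_point e (of_int b * t) 0 0)"
proof -
  let ?A = "\<lambda>\<tau> t. torus_point e ((1 - \<tau>) * \<theta> t + \<tau> * (of_int a * t)) ((1 - \<tau>) * r t) (\<tau> / 2)"
  let ?B = "\<lambda>\<tau> t. torus_point e ((1 - \<tau>) * \<theta>' t + \<tau> * (of_int b * t)) ((1 - \<tau>) * r' t) 0"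
  have c: "continuous_on UNIV \<theta>" "continuous_on UNIV \<theta>'" "continuous_on UNIV r" "continuous_on UNIV r'"
    using 1 2 by (auto simp: annular_loop_def)
  note cs = continuous_on_compose2[OF c(1) continuous_on_snd] continuous_on_compose2[OF c(2) continuous_on_snd]
    continuous_on_compose2[OF c(3) continuous_on_snd] continuous_on_compose2[OF c(4) continuous_on_snd]
  have "linking_number (?A 0) (?B 0) = linking_number (?A 1) (?B 1)"
  proof (rule linking_number_homotopic)
    show "continuous_on ({0..1} \<times> UNIV) (\<lambda>(\<tau>, t). ?A \<tau> t)"
      unfolding case_prod_unfold torus_point_def by (intro continuous_intros cs; simp)
    show "continuous_on ({0..1} \<times> UNIV) (\<lambda>(\<tau>, t). ?B \<tau> t)"
      unfolding case_prod_unfold torus_point_def by (intro continuous_intros cs; simp)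
    have per: "torus_point e ((1 - \<tau>) * (x + 2 * pi * of_int k) + \<tau> * (of_int k * (t + 2 * pi))) s u =
       torus_point e ((1 - \<tau>) * x + \<tau> * (of_int k * t)) s u" for \<tau> x k t s u
    proof (rule torus_point_cis_cong)
      have "(1 - \<tau>) * (x + 2 * pi * of_int k) + \<tau> * (of_int k * (t + 2 * pi)) =
        ((1 - \<tau>) * x + \<tau> * (of_int k * t)) + 2 * pi * of_int k"
        by (simp add: algebra_simps)
      then show "cis ((1 - \<tau>) * (x + 2 * pi * of_int k) + \<tau> * (of_int k * (t + 2 * pi))) =
        cis ((1 - \<tau>) * x + \<tau> * (of_int k * t))"
        by (simp only: cis_add_2pi_int)
    qed
    show "?A \<tau> (t + 2 * pi) = ?A \<tau> t" "?B \<tau> (t + 2 * pi) = ?B \<tau> t" for \<tau> t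
      using 1 2 unfolding annular_loop_def by (simp_all only: per)
    show "?A \<tau> s \<noteq> ?B \<tau> t" if \<tau>: "0 \<le> \<tau>" "\<tau> \<le> 1" for \<tau> s t
    proof
      have r: "\<bar>r s\<bar> \<le> 1" "\<bar>r' t\<bar> \<le> 1" using 1 2 by (auto simp: annular_loop_def)
      have b: "\<bar>(1 - \<tau>) * r s\<bar> + \<bar>\<tau> / 2\<bar> < 2" "\<bar>(1 - \<tau>) * r' t\<bar> + \<bar>0\<bar> < 2"
        using \<tau> r mult_mono[of "\<bar>1 - \<tau>\<bar>" 1 "\<bar>r s\<bar>" 1] mult_mono[of "\<bar>1 - \<tau>\<bar>" 1 "\<bar>r' t\<bar>" 1]
        by (auto simp: abs_mult)
      assume "?A \<tau> s = ?B \<tau> t"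
      from torus_point_inj(3)[OF e b this] have "\<tau> = 0" by simp
      with \<open>?A \<tau> s = ?B \<tau> t\<close> ne show False
        by (simp add: annulus_point_eq_torus_point)
    qed
  qed
  then show ?thesis
    by (simp add: annulus_point_eq_torus_point)
qed

lemma torus_loop_props:
  "continuous_on UNIV (\<lambda>t. torus_point e (of_int a * t) s u)"
  "torus_point e (of_int a * (t + 2 * pi)) s u = torus_point e (of_int a * t) s u"
proof -
  show "continuous_on UNIV (\<lambda>t. torus_point e (of_int a * t) s u)"
    unfolding torus_point_def by (intro continuous_intros)
  have "of_int a * (t + 2 * pi) = of_int a * t + 2 * pi * of_int a"
    by (simp add: algebra_simps)
  then show "torus_point e (of_int a * (t + 2 * pi)) s u = torus_point e (of_int a * t) s u"
    by (metis torus_point_cis_cong cis_add_2pi_int)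
qed

lemma torus_loops_disjoint: "e \<in> {-1, 1} \<Longrightarrow> torus_point e s 0 (1/2) \<noteq> torus_point e t 0 0"
  using torus_point_inj(3)[of e 0 "1/2" 0 0 s t] by auto

lemma linking_number_torus_1:
  "linking_number (\<lambda>t. torus_point 1 t 0 (1/2)) (\<lambda>t. torus_point 1 t 0 0) = 1"
proof -
  \<comment> \<open>A straight-line homotopy from the pushed-off core to the ellipse of
    \<open>linking_number_hopf\<close>. It meets the plane of the circle only where
    \<open>cos s = 0\<close>; there the first coordinate is 0 and the second is at most 3/2 or at
    most -5/2, and a nonnegative value occurs if \<open>sin s = 1\<close>, so it is never 2 or
    -2.\<close>
  let ?A = "\<lambda>\<tau> s. vector [(1 - \<tau>) * ((2 - sin s / 2) * cos s),
     (1 - \<tau>) * ((2 - sin s / 2) * sin s) + \<tau> * (2 * sin s - 2), ((1 - \<tau>) / 2 + \<tau>) * cos s] :: real^3"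
  let ?B = "\<lambda>t. vector [2 * cos t, 2 * sin t, 0] :: real^3"
  have "linking_number (?A 0) ?B = linking_number (?A 1) ?B"
  proof (rule linking_number_homotopic[of ?A "\<lambda>_. ?B"])
    show "?A \<tau> s \<noteq> ?B t" if \<tau>: "0 \<le> \<tau>" "\<tau> \<le> 1" for \<tau> s t
    proof
      assume eq: "?A \<tau> s = ?B t"
      then have "((1 - \<tau>) / 2 + \<tau>) * cos s = 0" by (simp add: vec_eq_iff forall_3)
      moreover have "(1 - \<tau>) / 2 + \<tau> > 0" using \<tau> by (simp add: field_simps)
      ultimately have cs: "cos s = 0" by simp
      then have "cos t = 0" and y: "(1 - \<tau>) * ((2 - sin s / 2) * sin s) + \<tau> * (2 * sin s - 2) = 2 * sin t"
        using eq by (simp_all add: vec_eq_iff forall_3)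
      then have "(sin t)\<^sup>2 = 1" "(sin s)\<^sup>2 = 1"
        using cs sin_cos_squared_add[of t] sin_cos_squared_add[of s] by auto
      then have "(sin t = 1 \<or> sin t = -1) \<and> (sin s = 1 \<or> sin s = -1)"
        by (simp add: power2_eq_1_iff)
      with y \<tau> show False by (auto simp: field_simps)
    qed
    show "continuous_on ({0..1} \<times> UNIV) (\<lambda>(\<tau>, t). ?A \<tau> t)"
      "continuous_on ({0..1} \<times> UNIV) (\<lambda>(\<tau>::real, t). ?B t)"
      unfolding case_prod_unfold by (intro continuous_intros; simp)+
  qed simp_all
  then show ?thesis
    using linking_number_hopf by (simp add: torus_point_def)
qed

lemma linking_number_torus:
  assumes "e \<in> {-1, 1}"
  shows "of_int (linking_number (\<lambda>t. torus_point e t 0 (1/2)) (\<lambda>t. torus_point e t 0 0)) = e"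
proof -
  have 1: "linking_number (mirror \<circ> (\<lambda>t. torus_point 1 t 0 (1/2))) (mirror \<circ> (\<lambda>t. torus_point 1 t 0 0)) =
     - linking_number (\<lambda>t. torus_point 1 t 0 (1/2)) (\<lambda>t. torus_point 1 t 0 0)"
    by (rule linking_number_mirror)
       (use torus_loop_props[of 1 1] torus_loops_disjoint[of 1] in auto)
  then show ?thesis
    using assms linking_number_torus_1 by (auto simp: o_def mirror_torus_point)
qed

text \<open>If one loop does not wind, the core loops have disjoint projections along the first
  axis. If both winding numbers are -1, reversing both loops leads back to the case 1.\<close>

lemma linking_number_annular:
  assumes e: "e \<in> {-1, 1}" and 1: "annular_loop \<theta> r a" and 2: "annular_loop \<theta>' r' b"
    and ne: "\<And>s t. annulus_point e (\<theta> s) (r s) \<noteq> annulus_point e (\<theta>' t) (r' t)"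
  defines "l \<equiv> linking_number (\<lambda>t. annulus_point e (\<theta> t) (r t)) (\<lambda>t. annulus_point e (\<theta>' t) (r' t))"
  shows "a = 0 \<or> b = 0 \<Longrightarrow> l = 0" and "a = b \<Longrightarrow> \<bar>a\<bar> = 1 \<Longrightarrow> of_int l = e"
proof -
  have l: "l = linking_number (\<lambda>t. torus_point e (of_int a * t) 0 (1/2)) (\<lambda>t. torus_point e (of_int b * t) 0 0)"
    unfolding l_def by (rule linking_number_annular_loops[OF e 1 2 ne])
  show "l = 0" if ab: "a = 0 \<or> b = 0"
    unfolding l
  proof (rule linking_number_eq_0[OF torus_loop_props(1) torus_loop_props(1) torus_loop_props(2) torus_loop_props(2) torus_loops_disjoint[OF e]])
    fix s t :: real
    define x y where "x = of_int a * s" and "y = of_int b * t"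
    assume "torus_point e (of_int a * s) 0 (1/2) $ 2 = torus_point e (of_int b * t) 0 0 $ 2"
      "torus_point e (of_int a * s) 0 (1/2) $ 3 = torus_point e (of_int b * t) 0 0 $ 3"
    then have yz: "(2 - sin x / 2) * sin x = 2 * sin y" "cos x = 0"
      using e by (auto simp: torus_point_def x_def y_def)
    have False
      using ab
    proof
      assume "a = 0" with yz show False by (simp add: x_def)
    next
      assume "b = 0"
      with yz have "sin x = 0 \<or> sin x = 4" by (auto simp: y_def)
      then have "sin x = 0" using sin_le_one[of x] by auto
      with yz(2) show False using sin_cos_squared_add[of x] by simp
    qed
    then show "torus_point e (of_int a * s) 0 (1/2) $ 1 \<le> torus_point e (of_int b * t) 0 0 $ 1" ..
  qed
  show "of_int l = e" if "a = b" "\<bar>a\<bar> = 1"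
  proof -
    have "linking_number (\<lambda>t. torus_point e (- t) 0 (1/2)) (\<lambda>t. torus_point e (- t) 0 0) =
      linking_number (\<lambda>t. torus_point e t 0 (1/2)) (\<lambda>t. torus_point e t 0 0)"
      by (rule linking_number_reverse)
         (use torus_loop_props[of e 1] torus_loops_disjoint[OF e] in auto)
    moreover have "a = 1 \<or> a = -1" using that by linarith
    ultimately show ?thesis
      using linking_number_torus[OF e] that(1) unfolding l by auto
  qed
qed

section \<open>Ladders with at least three rungs\<close>

lemma annular_loop_continuous:
  assumes "annular_loop \<theta> r a"
  shows "continuous_on S \<theta>" "continuous_on S r"
  using assms continuous_on_subset[OF _ subset_UNIV] unfolding annular_loop_def by blast+

lemma annular_loop_surj:
  assumes "annular_loop \<theta> r a" "a \<noteq> 0"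
  shows "\<exists>s. cis (\<theta> s) = cis \<phi>"
proof -
  note c = annular_loop_continuous(1)[OF assms(1)]
  have sh: "\<theta> (2 * pi) = \<theta> 0 + 2 * pi * of_int a"
    using assms(1) unfolding annular_loop_def by (metis add_0)
  \<comment> \<open>The number of full turns that moves \<open>\<phi>\<close> between
    \<open>\<theta> 0\<close> and \<open>\<theta> (2 * pi)\<close>, which are at least
    \<open>2 * pi\<close> apart.\<close>
  define k where "k = (if a > 0 then \<lceil>(\<theta> 0 - \<phi>) / (2 * pi)\<rceil> else \<lfloor>(\<theta> 0 - \<phi>) / (2 * pi)\<rfloor>)"
  define \<psi> where "\<psi> = \<phi> + 2 * pi * of_int k"
  have "\<exists>s. \<theta> s = \<psi>"
  proof (cases "a > 0")
    case True
    have "(\<theta> 0 - \<phi>) / (2 * pi) \<le> of_int k" "of_int k \<le> (\<theta> 0 - \<phi>) / (2 * pi) + 1"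
      using True by (simp_all add: k_def)
    then have "\<theta> 0 \<le> \<psi>" "\<psi> \<le> \<theta> 0 + 2 * pi"
      by (simp_all add: \<psi>_def field_simps)
    moreover have "2 * pi * 1 \<le> 2 * pi * of_int a"
      using True by (intro mult_left_mono) auto
    ultimately have "\<theta> 0 \<le> \<psi>" "\<psi> \<le> \<theta> (2 * pi)"
      unfolding sh by linarith+
    then show ?thesis
      using IVT'[of \<theta> 0 \<psi> "2 * pi"] c by auto
  next
    case False
    have "of_int k \<le> (\<theta> 0 - \<phi>) / (2 * pi)" "(\<theta> 0 - \<phi>) / (2 * pi) \<le> of_int k + 1"
      using False by (simp_all add: k_def)
    then have "\<psi> \<le> \<theta> 0" "\<theta> 0 - 2 * pi \<le> \<psi>"
      by (simp_all add: \<psi>_def field_simps)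
    moreover have "2 * pi * of_int a \<le> 2 * pi * (-1)"
      using False assms(2) by (intro mult_left_mono) auto
    ultimately have "\<psi> \<le> \<theta> 0" "\<theta> (2 * pi) \<le> \<psi>"
      unfolding sh by linarith+
    then show ?thesis
      using IVT2'[of \<theta> "2 * pi" \<psi> 0] c by auto
  qed
  then obtain s where "\<theta> s = \<psi>" by blast
  then have "cis (\<theta> s) = cis \<phi>"
    by (simp only: \<psi>_def cis_add_2pi_int)
  then show ?thesis by blast
qed

text \<open>By periodicity the curve of pairs \<open>(cis (\<theta> s), r s)\<close> is the compact
  image of one period, and the set is a preimage of it.\<close>

lemma annular_loop_level_closed:
  assumes "annular_loop \<theta> r a"
  shows "closed {\<phi>. \<exists>s. cis (\<theta> s) = cis \<phi> \<and> r s = c}"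
proof -
  define K where "K = (\<lambda>s. (cis (\<theta> s), r s)) ` {0..2 * pi}"
  note \<theta> = annular_loop_continuous(1)[OF assms] and r = annular_loop_continuous(2)[OF assms]
  have "compact K"
    unfolding K_def cis_conv_exp by (intro compact_continuous_image continuous_intros \<theta> r compact_Icc)
  have per: "(cis (\<theta> s), r s) \<in> K" for s
  proof -
    define k where "k = - \<lfloor>s / (2 * pi)\<rfloor>"
    have "- of_int k \<le> s / (2 * pi)" "s / (2 * pi) \<le> - of_int k + 1"
      by (simp_all add: k_def)
    then have "s + 2 * pi * of_int k \<in> {0..2 * pi}"
      by (simp add: field_simps)
    moreover have "(\<lambda>s. (cis (\<theta> s), r s)) (s + 2 * pi * of_int k) = (cis (\<theta> s), r s)"
      by (rule periodic_int) (use assms in \<open>simp add: annular_loop_def\<close>)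
    ultimately show ?thesis
      unfolding K_def by (metis (no_types, lifting) image_eqI)
  qed
  have "{\<phi>. \<exists>s. cis (\<theta> s) = cis \<phi> \<and> r s = c} = (\<lambda>\<phi>. (cis \<phi>, c)) -` K"
    using per by (auto simp: K_def) metis
  also have "closed \<dots>"
    by (intro closed_vimage compact_imp_closed[OF \<open>compact K\<close>]) (auto simp: cis_conv_exp intro!: continuous_intros)
  finally show ?thesis .
qed

text \<open>The complement is open, and it is countable since each direction has countably many
  angles; a nonempty open set of reals is uncountable.\<close>

lemma closed_superset_of_generic_angles:
  assumes "finite C" "closed K" "\<And>\<phi>. cis \<phi> \<notin> C \<Longrightarrow> \<phi> \<in> K"
  shows "K = UNIV"
proof (rule ccontr)
  assume "K \<noteq> UNIV"
  then obtain x where "x \<in> - K" by blast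
  moreover have "open (- K)" using assms(2) by (simp add: open_Compl)
  ultimately obtain d where d: "d > 0" "ball x d \<subseteq> - K"
    using open_contains_ball by blast
  have "countable {\<phi>. cis \<phi> = c}" for c
  proof (cases "\<exists>\<psi>. cis \<psi> = c")
    case True
    then obtain \<psi> where "cis \<psi> = c" by blast
    then have "{\<phi>. cis \<phi> = c} \<subseteq> range (\<lambda>k::int. \<psi> + 2 * pi * of_int k)"
      by (auto dest: cis_eq_imp_diff)
    then show ?thesis by (rule countable_subset) simp
  next
    case False
    then have "{\<phi>. cis \<phi> = c} = {}" by blast
    then show ?thesis by simp
  qed
  then have "countable (\<Union>c\<in>C. {\<phi>. cis \<phi> = c})"
    by (rule countable_UN[OF countable_finite[OF assms(1)]])
  moreover have "{x - d<..<x + d} \<subseteq> (\<Union>c\<in>C. {\<phi>. cis \<phi> = c})"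
    using d(2) assms(3) by (force simp: ball_def dist_real_def)
  ultimately have "countable {x - d<..<x + d}"
    using countable_subset by blast
  then show False
    using d(1) uncountable_open_interval[of "x - d" "x + d"] by auto
qed

text \<open>Over a generic angle the ladder has only two points. Two disjoint essential loops share
  them, so the set of angles where the first loop is on a given side is closed and open.\<close>

lemma disjoint_essential_loops_cover_sides:
  assumes l: "annular_loop \<theta> r a" "annular_loop \<theta>' r' b" and ab: "a \<noteq> 0" "b \<noteq> 0"
    and C: "finite C" "\<And>s. \<bar>r s\<bar> = 1 \<or> cis (\<theta> s) \<in> C" "\<And>t. \<bar>r' t\<bar> = 1 \<or> cis (\<theta>' t) \<in> C"
    and disj: "\<And>s t. cis (\<theta> s) = cis (\<theta>' t) \<Longrightarrow> r s \<noteq> r' t"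
  obtains \<delta> where "\<delta> \<in> {-1, 1::real}" "\<And>\<phi>. \<exists>s. cis (\<theta> s) = cis \<phi> \<and> r s = \<delta>" "\<And>\<phi>. \<exists>t. cis (\<theta>' t) = cis \<phi> \<and> r' t = - \<delta>"
proof -
  define S where "S c = {\<phi>. \<exists>s. cis (\<theta> s) = cis \<phi> \<and> r s = c}" for c
  define S' where "S' c = {\<phi>. \<exists>t. cis (\<theta>' t) = cis \<phi> \<and> r' t = c}" for c
  have cl: "closed (S c)" "closed (S' c)" for c
    unfolding S_def S'_def by (intro annular_loop_level_closed[OF l(1)] annular_loop_level_closed[OF l(2)])+
  have disj': "S c \<inter> S' c = {}" for c
    unfolding S_def S'_def using disj by auto metis
  \<comment> \<open>Angles where the first loop visits the side \<open>c\<close> and the second the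
    opposite one. Disjointness at generic angles gives a covering by \<open>K 1\<close> and
    \<open>K (-1)\<close>; closedness extends it to the angles of the rungs, and connectedness
    leaves only one of the two sets.\<close>
  define K where "K c = S c \<inter> S' (- c)" for c
  have K: "closed (K c)" for c
    unfolding K_def using cl by blast
  have un: "K 1 \<union> K (-1) = UNIV"
  proof (rule closed_superset_of_generic_angles[OF C(1)])
    show "closed (K 1 \<union> K (-1))" using K by blast
    fix \<phi> assume \<phi>: "cis \<phi> \<notin> C"
    obtain s t where s: "cis (\<theta> s) = cis \<phi>" and t: "cis (\<theta>' t) = cis \<phi>"
      using annular_loop_surj l ab by metis
    then have "\<bar>r s\<bar> = 1" "\<bar>r' t\<bar> = 1" "r s \<noteq> r' t"
      using C(2)[of s] C(3)[of t] disj[of s t] \<phi> by auto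
    then have "(r s = 1 \<and> r' t = -1) \<or> (r s = -1 \<and> r' t = 1)"
      by linarith
    then show "\<phi> \<in> K 1 \<union> K (-1)"
      unfolding K_def S_def S'_def using s t by fastforce
  qed
  have "K 1 \<inter> K (-1) = {}"
    unfolding K_def using disj' by auto
  then have "K 1 = {} \<or> K (-1) = {}"
    using connected_UNIV[where 'a=real] K un unfolding connected_closed by (metis Int_UNIV_right subset_UNIV)
  then have "K 1 = UNIV \<or> K (-1) = UNIV"
    using un by auto
  then obtain \<delta> where \<delta>: "\<delta> \<in> {-1, 1}" "K \<delta> = UNIV" by blast
  show thesis
    by (rule that[OF \<delta>(1)]) (use \<delta>(2) in \<open>auto simp: K_def S_def S'_def\<close>)
qed

text \<open>Every stage of the isotopy is injective, so the moving loops stay disjoint.\<close>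

lemma linking_number_isotopy:
  assumes h: "homotopic_with_canon self_homeo UNIV UNIV id h"
    and \<alpha>: "continuous_on UNIV \<alpha>" "\<And>t. \<alpha> (t + 2 * pi) = \<alpha> t"
    and \<beta>: "continuous_on UNIV \<beta>" "\<And>t. \<beta> (t + 2 * pi) = \<beta> t"
    and ne: "\<And>s t. \<alpha> s \<noteq> \<beta> t"
  shows "linking_number (\<lambda>t. h (\<alpha> t)) (\<lambda>t. h (\<beta> t)) = linking_number \<alpha> \<beta>"
proof -
  obtain H where H: "continuous_on ({0..1} \<times> UNIV) H" "\<And>x. H (0::real, x) = x" "\<And>x. H (1, x) = h x"
    "\<And>t. t \<in> {0..1} \<Longrightarrow> self_homeo (\<lambda>x. H (t, x))"
    using h unfolding homotopic_with_def
    by (auto simp: prod_topology_subtopology_eu simp del: subtopology_UNIV)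
  have cH: "continuous_on ({0..1} \<times> UNIV) (\<lambda>(\<tau>, t). H (\<tau>, \<gamma> t))" if "continuous_on UNIV \<gamma>" for \<gamma> :: "real \<Rightarrow> real^3"
    unfolding case_prod_unfold
    by (intro continuous_on_compose2[OF H(1)] continuous_intros continuous_on_compose2[OF that]) auto
  have "linking_number (\<lambda>t. H (0, \<alpha> t)) (\<lambda>t. H (0, \<beta> t)) = linking_number (\<lambda>t. H (1, \<alpha> t)) (\<lambda>t. H (1, \<beta> t))"
  proof (rule linking_number_homotopic[of "\<lambda>\<tau> t. H (\<tau>, \<alpha> t)" "\<lambda>\<tau> t. H (\<tau>, \<beta> t)"])
    show "H (\<tau>, \<alpha> s) \<noteq> H (\<tau>, \<beta> t)" if "0 \<le> \<tau>" "\<tau> \<le> 1" for \<tau> s t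
      using H(4)[of \<tau>] that ne[of s t] unfolding self_homeo_def homeomorphism_def by (metis UNIV_I atLeastAtMost_iff)
  qed (simp_all add: cH \<alpha> \<beta>)
  then show ?thesis by (simp add: H)
qed

section \<open>The image of the sides\<close>

definition rung_directions :: "nat \<Rightarrow> complex set" where
  "rung_directions n = (\<lambda>k. cis (2 * pi * real k / real n)) ` {..<n}"

lemma annulus_point_in_sides_iff:
  assumes "e \<in> {-1, 1}" "\<bar>s\<bar> \<le> 1"
  shows "annulus_point e t s \<in> sides e \<longleftrightarrow> \<bar>s\<bar> = 1"
proof
  assume "annulus_point e t s \<in> sides e"
  then obtain t' s' where "s' \<in> {-1, 1}" "annulus_point e t s = annulus_point e t' s'"
    unfolding sides_def by blast
  then show "\<bar>s\<bar> = 1"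
    using annulus_point_eq_iff[OF assms(1), of s s' t t'] assms(2) by auto
next
  assume "\<bar>s\<bar> = 1"
  then have "s \<in> {-1, 1}" by auto
  then show "annulus_point e t s \<in> sides e" unfolding sides_def by blast
qed

lemma standard_hopf_ladder_cases:
  assumes "x \<in> standard_hopf_ladder e n"
  obtains t s where "\<bar>s\<bar> \<le> 1" "x = annulus_point e t s" "\<bar>s\<bar> = 1 \<or> cis t \<in> rung_directions n"
proof -
  have "(\<exists>t s. s \<in> {-1, 1} \<and> x = annulus_point e t s) \<or>
        (\<exists>k<n. \<exists>s\<in>{-1..1}. x = annulus_point e (2 * pi * real k / real n) s)"
    using assms unfolding standard_hopf_ladder_def sides_def rung_def by blast
  then show thesis
  proof (elim disjE exE conjE bexE)
    fix t s assume "s \<in> {-1, 1::real}" "x = annulus_point e t s"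
    then show thesis by (intro that[of s t]) auto
  next
    fix k s assume "k < n" "s \<in> {-1..1}" "x = annulus_point e (2 * pi * real k / real n) s"
    then show thesis by (intro that[of s "2 * pi * real k / real n"]) (auto simp: rung_directions_def)
  qed
qed

lemma annulus_point_in_ladder:
  assumes "e \<in> {-1, 1}" "\<bar>s\<bar> \<le> 1" "annulus_point e t s \<in> standard_hopf_ladder e n"
  shows "\<bar>s\<bar> = 1 \<or> cis t \<in> rung_directions n"
  using assms(3)
proof (rule standard_hopf_ladder_cases)
  fix t' s' assume "\<bar>s'\<bar> \<le> 1" "annulus_point e t s = annulus_point e t' s'" "\<bar>s'\<bar> = 1 \<or> cis t' \<in> rung_directions n"
  then show ?thesis
    using annulus_point_eq_iff[OF assms(1,2), of s' t t'] by simp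
qed

lemma sides_subset_ladder: "sides e \<subseteq> standard_hopf_ladder e n"
  by (simp add: standard_hopf_ladder_def)

lemma continuous_on_annulus_point: "continuous_on S (\<lambda>t. annulus_point e t s)" "continuous_on S (\<lambda>s. annulus_point e t s)"
  unfolding annulus_point_def by (intro continuous_intros)+

lemma annulus_point_periodic: "annulus_point e (t + 2 * pi) s = annulus_point e t s"
  by (simp add: annulus_point_def)

text \<open>Both sides are parametrised in the same direction, so their linking number is
  \<open>e\<close>. In the mirror annulus the two computed cases would give 0 and
  \<open>- e\<close>. The winding numbers are not yet known to be 1 or -1, since a loop might still
  run along rungs.\<close>

lemma isotopy_on_sides:
  assumes e: "e \<in> {-1, 1}" and h: "homotopic_with_canon self_homeo UNIV UNIV id h"
    and L: "h ` standard_hopf_ladder e n = standard_hopf_ladder (- e) n"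
  obtains \<theta> r a \<theta>' r' b \<delta> where
    "annular_loop \<theta> r a" "\<And>t. h (annulus_point e t 1) = annulus_point (- e) (\<theta> t) (r t)"
    "annular_loop \<theta>' r' b" "\<And>t. h (annulus_point e t (-1)) = annulus_point (- e) (\<theta>' t) (r' t)"
    "a \<noteq> 0" "b \<noteq> 0" "\<not> (a = b \<and> \<bar>a\<bar> = 1)" "\<delta> \<in> {-1, 1::real}"
    "\<And>\<phi>. \<exists>s. cis (\<theta> s) = cis \<phi> \<and> r s = \<delta>" "\<And>\<phi>. \<exists>t. cis (\<theta>' t) = cis \<phi> \<and> r' t = - \<delta>"
proof -
  have e': "- e \<in> {-1, 1}" using e by auto
  have "self_homeo h" using homotopic_with_imp_property[OF h] by simp
  then have inj: "inj h" and ch: "continuous_on UNIV h"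
    unfolding self_homeo_def homeomorphism_def by (auto intro: inj_on_inverseI)
  have onL: "h (annulus_point e t s) \<in> standard_hopf_ladder (- e) n" if "s \<in> {-1, 1}" for t s
  proof -
    have "annulus_point e t s \<in> sides e" using that unfolding sides_def by blast
    then show ?thesis using L sides_subset_ladder[of e n] by blast
  qed
  have lift: "\<exists>\<theta> r a. annular_loop \<theta> r a \<and> (\<forall>t. h (annulus_point e t s) = annulus_point (- e) (\<theta> t) (r t))"
    if s: "s \<in> {-1, 1}" for s
  proof (rule annular_loop_lift[OF e', of "\<lambda>t. h (annulus_point e t s)"])
    show "continuous_on UNIV (\<lambda>t. h (annulus_point e t s))"
      by (rule continuous_on_compose2[OF ch continuous_on_annulus_point(1)]) simp
    show "h (annulus_point e (t + 2 * pi) s) = h (annulus_point e t s)" for t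
      by (simp add: annulus_point_periodic)
    show "\<exists>\<phi> s'. \<bar>s'\<bar> \<le> 1 \<and> h (annulus_point e t s) = annulus_point (- e) \<phi> s'" for t
      by (rule standard_hopf_ladder_cases[OF onL[OF s]]) blast
  qed blast
  obtain \<theta> r a where 1: "annular_loop \<theta> r a" "\<And>t. h (annulus_point e t 1) = annulus_point (- e) (\<theta> t) (r t)"
    using lift[of 1] by auto
  obtain \<theta>' r' b where 2: "annular_loop \<theta>' r' b" "\<And>t. h (annulus_point e t (-1)) = annulus_point (- e) (\<theta>' t) (r' t)"
    using lift[of "-1"] by auto
  have r: "\<bar>r t\<bar> \<le> 1" "\<bar>r' t\<bar> \<le> 1" for t
    using 1 2 by (auto simp: annular_loop_def)
  have sides_ne: "annulus_point e s 1 \<noteq> annulus_point e t (-1)" for s t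
    using annulus_point_eq_iff[OF e, of 1 "-1"] by simp
  have ne: "annulus_point (- e) (\<theta> s) (r s) \<noteq> annulus_point (- e) (\<theta>' t) (r' t)" for s t
    using sides_ne[of s t] inj by (metis 1(2) 2(2) injD)
  have std: "annular_loop (\<lambda>t. t) (\<lambda>t. 1) 1" "annular_loop (\<lambda>t. t) (\<lambda>t. -1) 1"
    by (auto simp: annular_loop_def)
  have "linking_number (\<lambda>t. h (annulus_point e t 1)) (\<lambda>t. h (annulus_point e t (-1))) =
     linking_number (\<lambda>t. annulus_point e t 1) (\<lambda>t. annulus_point e t (-1))"
    by (rule linking_number_isotopy[OF h]) (simp_all add: continuous_on_annulus_point annulus_point_periodic sides_ne)
  then have eq: "of_int (linking_number (\<lambda>t. annulus_point (- e) (\<theta> t) (r t)) (\<lambda>t. annulus_point (- e) (\<theta>' t) (r' t))) = e"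
    using linking_number_annular(2)[OF e std sides_ne] by (simp add: 1(2) 2(2))
  have ab: "a \<noteq> 0" "b \<noteq> 0"
    using linking_number_annular(1)[OF e' 1(1) 2(1) ne] eq e by auto
  have nab: "\<not> (a = b \<and> \<bar>a\<bar> = 1)"
    using linking_number_annular(2)[OF e' 1(1) 2(1) ne] eq e by auto
  show thesis
  proof (rule disjoint_essential_loops_cover_sides[OF 1(1) 2(1) ab, of "rung_directions n"])
    show "finite (rung_directions n)" by (simp add: rung_directions_def)
    show "\<bar>r s\<bar> = 1 \<or> cis (\<theta> s) \<in> rung_directions n" for s
      using annulus_point_in_ladder[OF e' r(1)] onL[of 1 s] by (simp add: 1(2))
    show "\<bar>r' s\<bar> = 1 \<or> cis (\<theta>' s) \<in> rung_directions n" for s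
      using annulus_point_in_ladder[OF e' r(2)] onL[of "-1" s] by (simp add: 2(2))
    show "r s \<noteq> r' t" if "cis (\<theta> s) = cis (\<theta>' t)" for s t
      using ne[of s t] annulus_point_eq_iff[OF e' r(1)[of s] r(2)[of t], of "\<theta> s" "\<theta>' t"] that by simp
  qed (rule that[OF 1 2 ab nab])
qed

lemma isotopy_sides_subset:
  assumes e: "e \<in> {-1, 1}" and h: "homotopic_with_canon self_homeo UNIV UNIV id h"
    and L: "h ` standard_hopf_ladder e n = standard_hopf_ladder (- e) n"
  shows "sides (- e) \<subseteq> h ` sides e"
proof (rule isotopy_on_sides[OF assms])
  fix \<theta> r a \<theta>' r' b \<delta>
  assume h1: "\<And>t. h (annulus_point e t 1) = annulus_point (- e) (\<theta> t) (r t)"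
    and h2: "\<And>t. h (annulus_point e t (-1)) = annulus_point (- e) (\<theta>' t) (r' t)"
    and \<delta>: "\<delta> \<in> {-1, 1::real}"
    and c1: "\<And>\<phi>. \<exists>s. cis (\<theta> s) = cis \<phi> \<and> r s = \<delta>" and c2: "\<And>\<phi>. \<exists>t. cis (\<theta>' t) = cis \<phi> \<and> r' t = - \<delta>"
  have sub: "annulus_point e t 1 \<in> sides e" "annulus_point e t (-1) \<in> sides e" for t
    using annulus_point_in_sides_iff[OF e] by simp_all
  show ?thesis
  proof
    fix x assume "x \<in> sides (- e)"
    then obtain \<phi> s where x: "x = annulus_point (- e) \<phi> s" "s \<in> {-1, 1}"
      unfolding sides_def by blast
    have cong: "annulus_point (- e) \<psi> s = annulus_point (- e) \<phi> s" if "cis \<psi> = cis \<phi>" for \<psi>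
      using torus_point_cis_cong[OF that] by (simp add: annulus_point_eq_torus_point)
    show "x \<in> h ` sides e"
    proof (cases "s = \<delta>")
      case True
      obtain t where t: "cis (\<theta> t) = cis \<phi>" "r t = s" using c1 True by blast
      have "x = h (annulus_point e t 1)" unfolding h1 t(2) x(1) cong[OF t(1)] ..
      then show ?thesis using sub by blast
    next
      case False
      then have "s = - \<delta>" using x \<delta> by auto
      then obtain t where t: "cis (\<theta>' t) = cis \<phi>" "r' t = s" using c2 by blast
      have "x = h (annulus_point e t (-1))" unfolding h2 t(2) x(1) cong[OF t(1)] ..
      then show ?thesis using sub by blast
    qed
  qed
qed

text \<open>The same inclusion for the inverse isotopy shows that no point of a side is mapped into
  the interior of a rung.\<close>

lemma isotopy_sides_eq:
  assumes e: "e \<in> {-1, 1}" and h: "homotopic_with_canon self_homeo UNIV UNIV id h"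
    and L: "h ` standard_hopf_ladder e n = standard_hopf_ladder (- e) n"
  shows "h ` sides e = sides (- e)"
proof
  show "sides (- e) \<subseteq> h ` sides e"
    by (rule isotopy_sides_subset[OF assms])
  obtain k where k: "homotopic_with_canon self_homeo UNIV UNIV id k" "k \<circ> h = id" "h \<circ> k = id"
    using isotopy_inverse[OF h] by blast
  have "k ` standard_hopf_ladder (- e) n = standard_hopf_ladder (- (- e)) n"
    unfolding L[symmetric] image_comp k(2) by simp
  then have "sides (- (- e)) \<subseteq> k ` sides (- e)"
    using e k(1) by (intro isotopy_sides_subset) auto
  then have "h ` sides e \<subseteq> h ` k ` sides (- e)"
    by (simp add: image_mono)
  then show "h ` sides e \<subseteq> sides (- e)"
    unfolding image_comp k(3) by simp
qed

section \<open>Cyclic order of angles\<close>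

text \<open>With more than one turn, the intermediate value theorem would bring the direction of
  \<open>\<theta> 0\<close> back within the period. Injectivity on the period makes
  \<open>\<theta>\<close> monotone, and the factor \<open>a\<close> turns a decreasing lift into an
  increasing one.\<close>

lemma injective_loop_increments:
  assumes l: "annular_loop \<theta> r a" and a: "a \<noteq> 0"
    and inj: "\<And>s t. cis (\<theta> s) = cis (\<theta> t) \<Longrightarrow> cis s = cis t"
    and t: "0 < t1" "t1 < t2" "t2 < 2 * pi"
  shows "\<bar>a\<bar> = 1" "0 < of_int a * (\<theta> t1 - \<theta> 0)" "of_int a * (\<theta> t1 - \<theta> 0) < of_int a * (\<theta> t2 - \<theta> 0)"
    "of_int a * (\<theta> t2 - \<theta> 0) < 2 * pi"
proof -
  note c = annular_loop_continuous(1)[OF l]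
  have sh: "\<theta> (t + 2 * pi) = \<theta> t + 2 * pi * of_int a" for t
    using l by (simp add: annular_loop_def)
  have sh0: "\<theta> (2 * pi) = \<theta> 0 + 2 * pi * of_int a"
    using sh[of 0] by simp
  have ends: "s = t \<or> \<bar>s - t\<bar> = 2 * pi" if "cis s = cis t" "s \<in> {0..2 * pi}" "t \<in> {0..2 * pi}" for s t
  proof -
    obtain k :: int where k: "s = t + 2 * pi * of_int k"
      using cis_eq_imp_diff[OF \<open>cis s = cis t\<close>] by blast
    have "\<bar>2 * pi * of_int k\<bar> \<le> 2 * pi" using that k by auto
    then have "\<bar>k\<bar> \<le> 1" by (simp add: abs_mult)
    then have "k = 0 \<or> \<bar>k\<bar> = 1" by linarith
    then show ?thesis unfolding k by (auto simp: abs_mult)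
  qed
  have inj_on: "inj_on \<theta> {0..2 * pi}"
  proof (rule inj_onI)
    fix s t assume st: "s \<in> {0..2 * pi}" "t \<in> {0..2 * pi}" "\<theta> s = \<theta> t"
    then have "s = t \<or> \<bar>s - t\<bar> = 2 * pi" using inj[of s t] ends by simp
    moreover have "\<bar>s - t\<bar> \<noteq> 2 * pi"
    proof
      assume "\<bar>s - t\<bar> = 2 * pi"
      then have "s = 0 \<and> t = 2 * pi \<or> s = 2 * pi \<and> t = 0" using st by auto
      then show False using st(3) sh0 a by auto
    qed
    ultimately show "s = t" by blast
  qed
  have no_full_turn: False if s: "s \<in> {0..2 * pi}" "\<theta> s = \<theta> 0 + 2 * pi * of_int d" "d \<noteq> 0" "d \<noteq> a" for s and d :: int
  proof -
    have "cis (\<theta> s) = cis (\<theta> 0)" by (simp only: s(2) cis_add_2pi_int)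
    then have "s = 0 \<or> \<bar>s\<bar> = 2 * pi" using inj[of s 0] ends[of s 0] s(1) by simp
    then have "s = 0 \<or> s = 2 * pi" using s(1) by auto
    then show False using s(2,3,4) sh0 by auto
  qed
  show a1: "\<bar>a\<bar> = 1"
  proof (rule ccontr)
    assume "\<bar>a\<bar> \<noteq> 1"
    then consider "a \<ge> 2" | "a \<le> -2" using a by linarith
    then show False
    proof cases
      case 1
      have "2 * pi * 1 \<le> 2 * pi * of_int a" using 1 by (intro mult_left_mono) auto
      then obtain s where "s \<in> {0..2 * pi}" "\<theta> s = \<theta> 0 + 2 * pi * of_int 1"
        using IVT'[of \<theta> 0 "\<theta> 0 + 2 * pi" "2 * pi"] c sh0 by auto
      then show False using no_full_turn[of s 1] 1 by auto
    next
      case 2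
      have "2 * pi * of_int a \<le> 2 * pi * (-1)" using 2 by (intro mult_left_mono) auto
      then obtain s where "s \<in> {0..2 * pi}" "\<theta> s = \<theta> 0 + 2 * pi * of_int (-1)"
        using IVT2'[of \<theta> "2 * pi" "\<theta> 0 - 2 * pi" 0] c sh0 by auto
      then show False using no_full_turn[of s "-1"] 2 by auto
    qed
  qed
  have m2: "(\<theta> 0 < \<theta> t2 \<and> \<theta> t2 < \<theta> (2 * pi)) \<or> (\<theta> (2 * pi) < \<theta> t2 \<and> \<theta> t2 < \<theta> 0)"
    using t by (intro continuous_inj_imp_mono c inj_on) auto
  have m1: "(\<theta> 0 < \<theta> t1 \<and> \<theta> t1 < \<theta> t2) \<or> (\<theta> t2 < \<theta> t1 \<and> \<theta> t1 < \<theta> 0)"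
    using t by (intro continuous_inj_imp_mono c inj_on_subset[OF inj_on]) auto
  have "a = 1 \<or> a = -1" using a1 by linarith
  moreover have "a = 1 \<Longrightarrow> \<theta> 0 < \<theta> (2 * pi)" "a = -1 \<Longrightarrow> \<theta> (2 * pi) < \<theta> 0"
    unfolding sh0 by simp_all
  ultimately have "(a = 1 \<and> \<theta> 0 < \<theta> t1 \<and> \<theta> t1 < \<theta> t2 \<and> \<theta> t2 < \<theta> (2 * pi)) \<or>
      (a = -1 \<and> \<theta> (2 * pi) < \<theta> t2 \<and> \<theta> t2 < \<theta> t1 \<and> \<theta> t1 < \<theta> 0)"
    using m1 m2 by force
  then show "0 < of_int a * (\<theta> t1 - \<theta> 0)" "of_int a * (\<theta> t1 - \<theta> 0) < of_int a * (\<theta> t2 - \<theta> 0)"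
    "of_int a * (\<theta> t2 - \<theta> 0) < 2 * pi"
    using sh0 by auto
qed

text \<open>An increasing and a decreasing lift that start at the same angle and meet again modulo a full
  turn differ there by exactly one full turn, which can happen only once.\<close>

lemma opposite_increments_agree_once:
  fixes x1 x2 y1 y2 :: real and j k :: int
  assumes "0 < x1" "x1 < x2" "x2 < 2 * pi" "- 2 * pi < y2" "y2 < y1" "y1 < 0"
    and "x1 = y1 + 2 * pi * of_int j" "x2 = y2 + 2 * pi * of_int k"
  shows False
proof -
  have "0 < 2 * pi * of_int j" "2 * pi * of_int j < 2 * pi * 2" "0 < 2 * pi * of_int k" "2 * pi * of_int k < 2 * pi * 2"
    using assms by linarith+
  then have "0 < j" "j < 2" "0 < k" "k < 2"
    by (simp_all add: zero_less_mult_iff)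
  then have "j = 1" "k = 1" by auto
  with assms show False by simp
qed

text \<open>Subtracting the values at 0, the first agreement, removes the ambiguity of the lifts.
  With opposite windings the increments have opposite signs, so two further agreements contradict
  \<open>opposite_increments_agree_once\<close>.\<close>

lemma loops_agreeing_at_three_points:
  assumes l: "annular_loop \<theta> r a" "annular_loop \<theta>' r' b" and ab: "a \<noteq> 0" "b \<noteq> 0"
    and inj: "\<And>s t. cis (\<theta> s) = cis (\<theta> t) \<Longrightarrow> cis s = cis t" "\<And>s t. cis (\<theta>' s) = cis (\<theta>' t) \<Longrightarrow> cis s = cis t"
    and t: "0 < t1" "t1 < t2" "t2 < 2 * pi"
    and agree: "\<And>t. t \<in> {0, t1, t2} \<Longrightarrow> cis (\<theta> t) = cis (\<theta>' t)"
  shows "a = b \<and> \<bar>a\<bar> = 1"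
proof (rule ccontr)
  assume "\<not> (a = b \<and> \<bar>a\<bar> = 1)"
  note i = injective_loop_increments[OF l(1) ab(1) inj(1) t] and i' = injective_loop_increments[OF l(2) ab(2) inj(2) t]
  obtain i0 i1 i2 :: int where k: "\<theta> 0 = \<theta>' 0 + 2 * pi * of_int i0" "\<theta> t1 = \<theta>' t1 + 2 * pi * of_int i1"
      "\<theta> t2 = \<theta>' t2 + 2 * pi * of_int i2"
    using agree cis_eq_imp_diff by (metis insertCI)
  have d: "\<theta> t1 - \<theta> 0 = (\<theta>' t1 - \<theta>' 0) + 2 * pi * of_int (i1 - i0)" "\<theta> t2 - \<theta> 0 = (\<theta>' t2 - \<theta>' 0) + 2 * pi * of_int (i2 - i0)"
    by (simp_all add: k algebra_simps)
  have d': "\<theta>' t1 - \<theta>' 0 = (\<theta> t1 - \<theta> 0) + 2 * pi * of_int (i0 - i1)" "\<theta>' t2 - \<theta>' 0 = (\<theta> t2 - \<theta> 0) + 2 * pi * of_int (i0 - i2)"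
    by (simp_all add: k algebra_simps)
  have "(a = 1 \<and> b = -1) \<or> (a = -1 \<and> b = 1)"
    using i(1) i'(1) \<open>\<not> (a = b \<and> \<bar>a\<bar> = 1)\<close> by linarith
  then show False
  proof
    assume "a = 1 \<and> b = -1"
    then show False
      using i(2-4) i'(2-4) by (intro opposite_increments_agree_once[OF _ _ _ _ _ _ d]) auto
  next
    assume "a = -1 \<and> b = 1"
    then show False
      using i(2-4) i'(2-4) by (intro opposite_increments_agree_once[OF _ _ _ _ _ _ d']) auto
  qed
qed

section \<open>The image of the rungs and the contradiction\<close>

lemma annulus_point_direction:
  assumes "\<bar>s\<bar> \<le> 1" "x = annulus_point e t s"
  shows "sgn (Complex (x $ 1) (x $ 2)) = cis t"
proof -
  have "Complex (x $ 1) (x $ 2) = (2 + s * cos t) *\<^sub>R cis t"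
    by (simp add: assms(2) annulus_point_def complex_eq_iff)
  moreover have "2 + s * cos t > 0"
    using torus_radius_pos[of s 0 t] assms(1) by simp
  ultimately show ?thesis
    by (simp add: sgn_scaleR sgn_div_norm)
qed

text \<open>The interior of a rung avoids the sides, so its image does too and has directions in the
  finite set \<open>rung_directions n\<close>. The direction is continuous, hence constant along the
  rung up to its ends.\<close>

lemma isotopy_on_rungs:
  assumes e: "e \<in> {-1, 1}" and h: "homotopic_with_canon self_homeo UNIV UNIV id h"
    and L: "h ` standard_hopf_ladder e n = standard_hopf_ladder (- e) n"
    and u: "cis u \<in> rung_directions n" "\<And>s. s \<in> {-1..1} \<Longrightarrow> annulus_point e u s \<in> standard_hopf_ladder e n"
    and \<phi>: "h (annulus_point e u 1) = annulus_point (- e) \<phi> s" "\<bar>s\<bar> \<le> 1"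
    and \<psi>: "h (annulus_point e u (-1)) = annulus_point (- e) \<psi> s'" "\<bar>s'\<bar> \<le> 1"
  shows "cis \<phi> = cis \<psi>"
proof -
  define g where "g v = sgn (Complex (h (annulus_point e u v) $ 1) (h (annulus_point e u v) $ 2))" for v
  have "self_homeo h" using homotopic_with_imp_property[OF h] by simp
  then have inj: "inj h" and ch: "continuous_on UNIV h"
    unfolding self_homeo_def homeomorphism_def by (auto intro: inj_on_inverseI)
  have cases: "\<exists>t w. h (annulus_point e u v) = annulus_point (- e) t w \<and> \<bar>w\<bar> \<le> 1 \<and> (\<bar>w\<bar> = 1 \<or> cis t \<in> rung_directions n)"
    if "v \<in> {-1..1}" for v
  proof -
    have "h (annulus_point e u v) \<in> standard_hopf_ladder (- e) n"
      using u(2)[OF that] L by blast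
    then show ?thesis by (rule standard_hopf_ladder_cases) blast
  qed
  have nz: "Complex (h (annulus_point e u v) $ 1) (h (annulus_point e u v) $ 2) \<noteq> 0" if "v \<in> {-1..1}" for v
    using cases[OF that] annulus_point_direction by (metis cis_neq_zero sgn_zero)
  have ca: "continuous_on S (\<lambda>v. h (annulus_point e u v))" for S
    by (rule continuous_on_compose2[OF ch continuous_on_annulus_point(2)]) simp
  have cg: "continuous_on {-1..1} g"
    unfolding g_def sgn_div_norm using nz unfolding Complex_eq
    by (intro continuous_intros ca) auto
  have dir: "g v \<in> rung_directions n" if v: "v \<in> {-1<..<1}" for v
  proof -
    obtain t w where w: "h (annulus_point e u v) = annulus_point (- e) t w" "\<bar>w\<bar> \<le> 1" "\<bar>w\<bar> = 1 \<or> cis t \<in> rung_directions n"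
      using cases[of v] v by auto
    have "annulus_point e u v \<notin> sides e"
      using annulus_point_in_sides_iff[OF e, of v u] v by (simp add: abs_if)
    then have "h (annulus_point e u v) \<notin> sides (- e)"
      unfolding isotopy_sides_eq[OF e h L, symmetric] using inj by (simp add: inj_image_mem_iff)
    then have "cis t \<in> rung_directions n"
      using annulus_point_in_sides_iff[of "- e" w t] e w by auto
    then show ?thesis
      unfolding g_def using annulus_point_direction[OF w(2,1)] by simp
  qed
  have "g constant_on {-1<..<1}"
  proof (rule continuous_finite_range_constant)
    have "g ` {-1<..<1} \<subseteq> rung_directions n" using dir by blast
    then show "finite (g ` {-1<..<1})"
      by (rule finite_subset) (simp add: rung_directions_def)
    show "continuous_on {-1<..<1} g"
      by (rule continuous_on_subset[OF cg]) auto
  qed (auto intro: convex_connected)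
  then obtain c where c: "\<And>v. v \<in> {-1<..<1} \<Longrightarrow> g v = c"
    by (auto simp: constant_on_def)
  have cl: "closure {-1<..<1::real} = {-1..1}"
    by (rule closure_greaterThanLessThan) simp
  have "g 1 = c" "g (-1) = c"
    using continuous_constant_on_closure[of "{-1<..<1}" g c] cg c unfolding cl by auto
  then show ?thesis
    unfolding g_def using annulus_point_direction[OF \<phi>(2,1)] annulus_point_direction[OF \<psi>(2,1)] by simp
qed

lemma standard_hopf_ladder_not_isotopic_mirror:
  assumes n: "n \<ge> 3" and e: "e \<in> {-1, 1}"
  shows "\<not> ambient_isotopic (standard_hopf_ladder e n) (standard_hopf_ladder (- e) n)"
proof
  assume "ambient_isotopic (standard_hopf_ladder e n) (standard_hopf_ladder (- e) n)"
  then obtain h where h: "homotopic_with_canon self_homeo UNIV UNIV id h"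
    and L: "h ` standard_hopf_ladder e n = standard_hopf_ladder (- e) n"
    unfolding ambient_isotopic_iff by blast
  have e': "- e \<in> {-1, 1}" using e by auto
  have "self_homeo h" using homotopic_with_imp_property[OF h] by simp
  then have inj: "inj h"
    unfolding self_homeo_def homeomorphism_def by (auto intro: inj_on_inverseI)
  show False
  proof (rule isotopy_on_sides[OF e h L])
    fix \<theta> r a \<theta>' r' b \<delta>
    assume l: "annular_loop \<theta> r a" "annular_loop \<theta>' r' b"
      and h1: "\<And>t. h (annulus_point e t 1) = annulus_point (- e) (\<theta> t) (r t)"
      and h2: "\<And>t. h (annulus_point e t (-1)) = annulus_point (- e) (\<theta>' t) (r' t)"
      and ab: "a \<noteq> 0" "b \<noteq> 0" "\<not> (a = b \<and> \<bar>a\<bar> = 1)"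
      and \<delta>: "\<delta> \<in> {-1, 1::real}"
      and c1: "\<And>\<phi>. \<exists>s. cis (\<theta> s) = cis \<phi> \<and> r s = \<delta>" and c2: "\<And>\<phi>. \<exists>t. cis (\<theta>' t) = cis \<phi> \<and> r' t = - \<delta>"
    have r: "\<bar>r t\<bar> \<le> 1" "\<bar>r' t\<bar> \<le> 1" for t
      using l by (auto simp: annular_loop_def)
    have on_sides: "\<bar>r t\<bar> = 1" "\<bar>r' t\<bar> = 1" for t
    proof -
      have "annulus_point e t 1 \<in> sides e" "annulus_point e t (-1) \<in> sides e"
        using annulus_point_in_sides_iff[OF e] by simp_all
      then have "annulus_point (- e) (\<theta> t) (r t) \<in> sides (- e)" "annulus_point (- e) (\<theta>' t) (r' t) \<in> sides (- e)"
        unfolding isotopy_sides_eq[OF e h L, symmetric] h1[symmetric] h2[symmetric] by blast+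
      then show "\<bar>r t\<bar> = 1" "\<bar>r' t\<bar> = 1"
        using annulus_point_in_sides_iff[OF e' r(1)] annulus_point_in_sides_iff[OF e' r(2)] by blast+
    qed
    have eq_iff: "annulus_point e s p = annulus_point e t q \<longleftrightarrow> cis s = cis t \<and> p = q" if "p \<in> {-1, 1}" "q \<in> {-1, 1}" for s t p q
      using annulus_point_eq_iff[OF e, of p q] that by auto
    have ne: "h (annulus_point e s 1) \<noteq> h (annulus_point e t (-1))" for s t
      using inj eq_iff[of 1 "-1" s t] by (auto dest: injD)
    have disj: "cis (\<theta> s) = cis (\<theta>' t) \<Longrightarrow> r s \<noteq> r' t" for s t
      using ne[of s t] annulus_point_eq_iff[OF e' r(1)[of s] r(2)[of t], of "\<theta> s" "\<theta>' t"] unfolding h1 h2 by blast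
    \<comment> \<open>The second loop covers the whole side \<open>- \<delta>\<close>, so the first
      loop, confined to the two sides, stays on the other one.\<close>
    have r_eq: "r t = \<delta>" for t
    proof -
      obtain s where "cis (\<theta>' s) = cis (\<theta> t)" "r' s = - \<delta>" using c2 by blast
      then have "r t \<noteq> - \<delta>" using disj[of t s] by simp
      then show ?thesis using on_sides(1)[of t] \<delta> by auto
    qed
    have r'_eq: "r' t = - \<delta>" for t
    proof -
      obtain s where "cis (\<theta> s) = cis (\<theta>' t)" "r s = \<delta>" using c1 by blast
      then have "r' t \<noteq> \<delta>" using disj[of s t] by simp
      then show ?thesis using on_sides(2)[of t] \<delta> by auto
    qed
    have inj1: "cis s = cis t" if "cis (\<theta> s) = cis (\<theta> t)" for s t
    proof -
      have "h (annulus_point e s 1) = h (annulus_point e t 1)"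
        unfolding h1 r_eq using torus_point_cis_cong[OF that] by (simp add: annulus_point_eq_torus_point)
      then show ?thesis using inj eq_iff[of 1 1 s t] by (auto dest: injD)
    qed
    have inj2: "cis s = cis t" if "cis (\<theta>' s) = cis (\<theta>' t)" for s t
    proof -
      have "h (annulus_point e s (-1)) = h (annulus_point e t (-1))"
        unfolding h2 r'_eq using torus_point_cis_cong[OF that] by (simp add: annulus_point_eq_torus_point)
      then show ?thesis using inj eq_iff[of "-1" "-1" s t] by (auto dest: injD)
    qed
    have agree: "cis (\<theta> (2 * pi * real k / real n)) = cis (\<theta>' (2 * pi * real k / real n))" if "k < n" for k
    proof (rule isotopy_on_rungs[OF e h L _ _ h1 r(1) h2 r(2)])
      show "cis (2 * pi * real k / real n) \<in> rung_directions n"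
        using that by (auto simp: rung_directions_def)
      show "annulus_point e (2 * pi * real k / real n) s \<in> standard_hopf_ladder e n" if "s \<in> {-1..1}" for s
        using that \<open>k < n\<close> unfolding standard_hopf_ladder_def rung_def by blast
    qed
    have "a = b \<and> \<bar>a\<bar> = 1"
    proof (rule loops_agreeing_at_three_points[OF l ab(1,2) inj1 inj2])
      \<comment> \<open>The angles of the first three rungs; the last inequality is where
        \<open>n \<ge> 3\<close> enters.\<close>
      show "0 < 2 * pi / real n" "2 * pi / real n < 4 * pi / real n" "4 * pi / real n < 2 * pi"
        using n by (simp_all add: field_simps)
      show "cis (\<theta> t) = cis (\<theta>' t)" if "t \<in> {0, 2 * pi / real n, 4 * pi / real n}" for t
        using that agree[of 0] agree[of 1] agree[of 2] n by auto
    qed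
    with ab(3) show False ..
  qed
qed

theorem proposition1p1:
  fixes n :: nat and L :: "(real^3) set"
  assumes "hopf_ladder n L"
  shows "(n \<le> 2 \<longrightarrow> achiral L) \<and> (n \<ge> 3 \<longrightarrow> chiral L)"
proof -
  obtain e where "e \<in> {-1, 1}"
    "achiral L \<longleftrightarrow> ambient_isotopic (standard_hopf_ladder e n) (standard_hopf_ladder (- e) n)"
    using hopf_ladder_achiral_iff[OF assms] by blast
  then show ?thesis
    using standard_hopf_ladder_isotopic_mirror[of n e] standard_hopf_ladder_not_isotopic_mirror[of n e]
    by (auto simp: achiral_def)
qed

end
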